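(* Let $(X_n)_{n\ge 0}$ be an excited random walk on $\mathbb{Z}$ with at most $M$ cookies per site whose environment law $\mathbb{P}$ on $\Omega_M$ satisfies the i.i.d. assumption (I) and the ellipticity assumption (E) stated in the context, and let $\delta$ be the average total drift per site. If $\delta\in[-1,1]$, then the walk is recurrent, i.e. for $\mathbb{P}$-almost all environments $\omega$ it returns $P_{0,\omega}$-a.s. infinitely many times to its starting point. If $\delta>1$, then the walk is transient to the right, i.e. for $\mathbb{P}$-almost all environments $\omega$, $X_n\to\infty$ as $n\to\infty$, $P_{0,\omega}$-a.s. If $\delta<-1$, then the walk is transient to the left, i.e. for $\mathbb{P}$-almost all environments $\omega$, $X_n\to-\infty$ as $n\to\infty$, $P_{0,\omega}$-a.s.
   Context: Fix $M\in\mathbb{N}=\{1,2,\dots\}$. A cookie environment is an element of $\Omega_M:=\{((\omega(z,i))_{i\in\mathbb{N}})_{z\in\mathbb{Z}} : \omega(z,i)\in[0,1]\ \forall i\in\{1,\dots,M\},\ \omega(z,i)=1/2\ \forall i>M,\ \forall z\in\mathbb{Z}\}$. For $\omega\in\Omega_M$ and $x\in\mathbb{Z}$, the excited random walk (ERW) $(X_n)_{n\ge0}$ starting from $x$ in the environment $\omega$ is a process under a probability measure $P_{x,\omega}$ with $P_{x,\omega}[X_0=x]=1$, $P_{x,\omega}[X_{n+1}=X_n+1\mid (X_i)_{0\le i\le n}]=\omega(X_n,\#\{i\le n: X_i=X_n\})$ and $P_{x,\omega}[X_{n+1}=X_n-1\mid (X_i)_{0\le i\le n}]=1-\omega(X_n,\#\{i\le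 n: X_i=X_n\})$. The environment $\omega$ is random with law $\mathbb{P}$ on $\Omega_M$ (expectation $\mathbb{E}$). Assumptions on $\mathbb{P}$: (I) the sequence $(\omega(z,\cdot))_{z\in\mathbb{Z}}$ is i.i.d. under $\mathbb{P}$ (different cookies at the same site may be dependent); (E) $\mathbb{E}\left[\prod_{i=1}^M\omega(0,i)\right]>0$ and $\mathbb{E}\left[\prod_{i=1}^M(1-\omega(0,i))\right]>0$. The average total drift per site is $\delta:=\mathbb{E}\left[\sum_{i=1}^M(2\omega(0,i)-1)\right]$. *)

theory Defs
  imports "HOL-Probability.Probability"
begin

(* Cookies are numbered from 1: the value at index 0 is the dummy value prescribed by
   extensionality, so that cookie_space is the product sigma-algebra over {1, 2, ...}. *)
definition cookie_space :: "(nat \<Rightarrow> real) measure" where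
  "cookie_space = (\<Pi>\<^sub>M i\<in>{1..}. borel)"

definition cookie_envs :: "nat \<Rightarrow> (int \<Rightarrow> nat \<Rightarrow> real) set" where
  "cookie_envs M = {\<omega>. \<forall>z. \<omega> z \<in> extensional {1..} \<and>
     (\<forall>i\<in>{1..M}. \<omega> z i \<in> {0..1}) \<and> (\<forall>i>M. \<omega> z i = 1 / 2)}"

definition env_space :: "nat \<Rightarrow> (int \<Rightarrow> nat \<Rightarrow> real) measure" where
  "env_space M = restrict_space (\<Pi>\<^sub>M z\<in>UNIV. cookie_space) (cookie_envs M)"

definition iid_env :: "(int \<Rightarrow> nat \<Rightarrow> real) measure \<Rightarrow> bool" where
  "iid_env P \<longleftrightarrow>
     prob_space.indep_vars P (\<lambda>z. cookie_space) (\<lambda>z \<omega>. \<omega> z) UNIV \<and>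
     (\<forall>z. distr P cookie_space (\<lambda>\<omega>. \<omega> z) = distr P cookie_space (\<lambda>\<omega>. \<omega> 0))"

definition elliptic_env :: "nat \<Rightarrow> (int \<Rightarrow> nat \<Rightarrow> real) measure \<Rightarrow> bool" where
  "elliptic_env M P \<longleftrightarrow>
     (LINT \<omega>|P. (\<Prod>i=1..M. \<omega> 0 i)) > 0 \<and> (LINT \<omega>|P. (\<Prod>i=1..M. 1 - \<omega> 0 i)) > 0"

definition total_drift :: "nat \<Rightarrow> (int \<Rightarrow> nat \<Rightarrow> real) measure \<Rightarrow> real" where
  "total_drift M P = (LINT \<omega>|P. (\<Sum>i=1..M. 2 * \<omega> 0 i - 1))"

(* The sigma-algebra generated by X 0, ..., X n. *)
definition history :: "'b measure \<Rightarrow> (nat \<Rightarrow> 'b \<Rightarrow> int) \<Rightarrow> nat \<Rightarrow> 'b measure" where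
  "history Q X n =
     vimage_algebra (space Q) (\<lambda>\<xi>. \<lambda>i\<in>{..n}. X i \<xi>) (\<Pi>\<^sub>M i\<in>{..n}. count_space UNIV)"

definition num_visits :: "(nat \<Rightarrow> 'b \<Rightarrow> int) \<Rightarrow> nat \<Rightarrow> 'b \<Rightarrow> nat" where
  "num_visits X n \<xi> = card {i. i \<le> n \<and> X i \<xi> = X n \<xi>}"

definition excited_random_walk ::
  "(int \<Rightarrow> nat \<Rightarrow> real) \<Rightarrow> int \<Rightarrow> 'b measure \<Rightarrow> (nat \<Rightarrow> 'b \<Rightarrow> int) \<Rightarrow> bool" where
  "excited_random_walk \<omega> x Q X \<longleftrightarrow>
     prob_space Q \<and>
     (\<forall>n. X n \<in> measurable Q (count_space UNIV)) \<and>
     measure Q {\<xi>\<in>space Q. X 0 \<xi> = x} = 1 \<and>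
     (\<forall>n. AE \<xi> in Q.
        real_cond_exp Q (history Q X n) (indicator {\<xi>\<in>space Q. X (Suc n) \<xi> = X n \<xi> + 1}) \<xi>
          = \<omega> (X n \<xi>) (num_visits X n \<xi>)) \<and>
     (\<forall>n. AE \<xi> in Q.
        real_cond_exp Q (history Q X n) (indicator {\<xi>\<in>space Q. X (Suc n) \<xi> = X n \<xi> - 1}) \<xi>
          = 1 - \<omega> (X n \<xi>) (num_visits X n \<xi>))"

end

theory Submission
  imports Defs "HOL-Real_Asymp.Real_Asymp"
begin

text \<open>
  Toss at each site the coins prescribed by its cookies. The numbers of steps from \<open>k\<close> to \<open>k + 1\<close>
  made before the \<open>m\<close>-th return from 1 to 0 form a Markov chain in \<open>k\<close>: the next value is the number
  of successes before the \<open>v\<close>-th failure at the next site, where \<open>v\<close> is the current value. All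
  excursions to the right are finite iff this chain dies out for every \<open>m\<close>, and if 0 is visited
  infinitely often then it does die out for every \<open>m\<close>; likewise on the left.

  With fair coins the offspring distribution maps \<open>a\<^sup>v\<close> to \<open>(1 / (2 - a))\<^sup>v\<close>, so that for
  \<open>a\<^sub>t = t / (t + 1)\<close> the function \<open>e\<^sub>t(v) = a\<^sub>t\<^sup>v\<close> becomes \<open>e\<^bsub>t+1\<^esub>\<close>. The cookies only contribute the
  factor \<open>E \<Prod>(1 - (2 \<omega>\<^sub>i - 1) / (t + 1)) = 1 - \<delta> / (t + 1) + O(1 / t\<^sup>2)\<close>. Hence superharmonic functions
  can be sought among the mixtures of the \<open>e\<^sub>t\<close>, with an inequality to check for the weights only. For
  \<open>\<delta> > 1\<close> a summable weight gives a superharmonic function decreasing to 0, so the extinction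
  probability from \<open>m\<close> tends to 0. For \<open>\<delta> \<le> 1\<close> a weight close to \<open>1 / t\<close> gives the function
  \<open>\<Sum>(1 - e\<^sub>t) w\<^sub>t\<close>, which increases to infinity and is superharmonic outside a finite set; together
  with ellipticity this forces extinction.
\<close>

section \<open>Successes before the m-th failure\<close>

primrec heads :: "(nat \<Rightarrow> bool) \<Rightarrow> nat \<Rightarrow> nat" where
  "heads b 0 = 0"
| "heads b (Suc n) = heads b n + (if b n then 1 else 0)"

definition tails :: "(nat \<Rightarrow> bool) \<Rightarrow> nat \<Rightarrow> nat" where
  "tails b = heads (\<lambda>i. \<not> b i)"

lemma tails_simps [simp]:
  "tails b 0 = 0" "tails b (Suc n) = tails b n + (if b n then 0 else 1)"
  by (auto simp: tails_def)

lemma mono_heads: "mono (heads b)"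
  by (rule mono_iff_le_Suc[THEN iffD2]) simp

lemma heads_le: "heads b n \<le> n"
  by (induction n) auto

lemma heads_Suc_shift: "heads b (Suc n) = (if b 0 then 1 else 0) + heads (\<lambda>i. b (Suc i)) n"
  by (induction n) auto

lemma tails_Suc_shift: "tails b (Suc n) = (if b 0 then 0 else 1) + tails (\<lambda>i. b (Suc i)) n"
  unfolding tails_def heads_Suc_shift by simp

lemma mono_tails: "mono (tails b)"
  unfolding tails_def by (rule mono_heads)

definition reaches :: "nat \<Rightarrow> (nat \<Rightarrow> bool) \<Rightarrow> bool" where
  "reaches m b \<longleftrightarrow> (\<exists>N. m \<le> tails b N)"

text \<open>The shortest prefix with \<open>m\<close> failures ends with the \<open>m\<close>-th
  failure, so its successes are those before that failure. Without \<open>reaches m b\<close> the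
  \<open>LEAST\<close> is unspecified.\<close>

definition progeny :: "nat \<Rightarrow> (nat \<Rightarrow> bool) \<Rightarrow> nat" where
  "progeny m b = heads b (LEAST N. m \<le> tails b N)"

lemma progeny_0 [simp]: "progeny 0 b = 0"
  by (simp add: progeny_def)

lemma reaches_0 [simp]: "reaches 0 b"
  by (simp add: reaches_def)

lemma heads_le_progeny:
  assumes "reaches m b" "tails b N < m"
  shows "heads b N \<le> progeny m b"
proof -
  have "m \<le> tails b (LEAST N. m \<le> tails b N)"
    using assms(1) unfolding reaches_def by (rule LeastI_ex)
  with assms(2) have "\<not> (LEAST N. m \<le> tails b N) \<le> N"
    using monoD[OF mono_tails, of "LEAST N. m \<le> tails b N" N b] by linarith
  then show ?thesis
    unfolding progeny_def by (intro monoD[OF mono_heads]) simp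
qed

lemma progeny_le_heads: "m \<le> tails b N \<Longrightarrow> progeny m b \<le> heads b N"
  unfolding progeny_def by (intro monoD[OF mono_heads] Least_le)

lemma progeny_mono:
  assumes "m \<le> m'" "reaches m' b"
  shows "progeny m b \<le> progeny m' b"
proof -
  have "m' \<le> tails b (LEAST N. m' \<le> tails b N)"
    using assms(2) unfolding reaches_def by (rule LeastI_ex)
  then show ?thesis
    unfolding progeny_def[of m'] using assms(1) by (intro progeny_le_heads) simp
qed

lemma reaches_Suc_shift:
  "reaches (Suc m) b \<longleftrightarrow> reaches (if b 0 then Suc m else m) (\<lambda>i. b (Suc i))"
proof -
  have "reaches (Suc m) b \<longleftrightarrow> (\<exists>N. Suc m \<le> tails b (Suc N))"
    unfolding reaches_def
    by (metis Suc_neq_Zero le_zero_eq tails_simps(1) not0_implies_Suc)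
  then show ?thesis
    unfolding reaches_def tails_Suc_shift by auto
qed

text \<open>First-toss recursion: a success leaves the required number of failures unchanged, a
  failure lowers it by one. The generating function of a site is computed from this.\<close>

lemma progeny_Suc_shift:
  assumes "reaches (Suc m) b"
  shows "progeny (Suc m) b =
    (if b 0 then Suc (progeny (Suc m) (\<lambda>i. b (Suc i))) else progeny m (\<lambda>i. b (Suc i)))"
proof -
  have "(LEAST N. Suc m \<le> tails b N) = Suc (LEAST N. Suc m \<le> tails b (Suc N))"
    using assms unfolding reaches_def
    by (elim exE, intro Least_Suc) (auto simp del: tails_simps(2))
  then show ?thesis
    by (simp add: progeny_def heads_Suc_shift tails_Suc_shift del: heads.simps(2) tails_simps(2))
qed

section \<open>The walk driven by coins\<close>

primrec walk :: "(int \<Rightarrow> nat \<Rightarrow> bool) \<Rightarrow> nat \<Rightarrow> int \<times> (int \<Rightarrow> nat)" where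
  "walk c 0 = (0, \<lambda>_. 0)"
| "walk c (Suc n) = (case walk c n of (x, N) \<Rightarrow>
     (x + (if c x (N x) then 1 else -1), N(x := Suc (N x))))"

definition pos :: "(int \<Rightarrow> nat \<Rightarrow> bool) \<Rightarrow> nat \<Rightarrow> int" where
  "pos c n = fst (walk c n)"

definition cnt :: "(int \<Rightarrow> nat \<Rightarrow> bool) \<Rightarrow> nat \<Rightarrow> int \<Rightarrow> nat" where
  "cnt c n = snd (walk c n)"

lemma pos_0 [simp]: "pos c 0 = 0"
  and pos_Suc: "pos c (Suc n) = pos c n + (if c (pos c n) (cnt c n (pos c n)) then 1 else -1)"
  and cnt_0 [simp]: "cnt c 0 z = 0"
  and cnt_Suc: "cnt c (Suc n) z = cnt c n z + (if z = pos c n then 1 else 0)"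
  by (auto simp: pos_def cnt_def split: prod.splits)

lemma cnt_eq_card: "cnt c n z = card {i. i < n \<and> pos c i = z}"
proof (induction n)
  case (Suc n)
  have "{i. i < Suc n \<and> pos c i = z} =
      (if z = pos c n then insert n {i. i < n \<and> pos c i = z} else {i. i < n \<and> pos c i = z})"
    by (auto simp: less_Suc_eq)
  then show ?case
    using Suc by (simp add: cnt_Suc)
qed simp

lemma mono_cnt: "mono (\<lambda>n. cnt c n z)"
  by (rule mono_iff_le_Suc[THEN iffD2]) (simp add: cnt_Suc)

lemma cnt_unbounded:
  assumes "infinite {n. pos c n = x}"
  shows "\<exists>n. B \<le> cnt c n x"
proof -
  obtain S where S: "S \<subseteq> {n. pos c n = x}" "finite S" "card S = B"
    using infinite_arbitrarily_large[OF assms] by auto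
  obtain n where "\<forall>i\<in>S. i < n"
    using S(2) finite_nat_set_iff_bounded by blast
  then have "card S \<le> cnt c n x"
    unfolding cnt_eq_card using S(1) by (intro card_mono) auto
  with S show ?thesis by auto
qed

lemma abs_pos_le: "\<bar>pos c n\<bar> \<le> int n"
  by (induction n) (auto simp: pos_Suc)

lemma cnt_outside:
  assumes "int n \<le> \<bar>z\<bar>"
  shows "cnt c n z = 0"
proof -
  have "pos c i \<noteq> z" if "i < n" for i
    using abs_pos_le[of c i] that assms by auto
  then show ?thesis by (simp add: cnt_eq_card)
qed

text \<open>The flag \<open>s\<close> selects the half line: right (\<open>s = True\<close>) or left. In a \<open>row\<close> a success is
  always a step away from the origin.\<close>

definition side :: "bool \<Rightarrow> int \<Rightarrow> int" where
  "side s x = (if s then x else - x)"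

definition row :: "bool \<Rightarrow> (int \<Rightarrow> nat \<Rightarrow> bool) \<Rightarrow> nat \<Rightarrow> nat \<Rightarrow> bool" where
  "row s c k = (\<lambda>i. c (side s (int k)) i = s)"

lemma side_side [simp]: "side s (side s x) = x"
  by (simp add: side_def)

lemma side_0 [simp]: "side s 0 = 0"
  by (simp add: side_def)

lemma side_eq_iff: "side s x = y \<longleftrightarrow> x = side s y"
  by (auto simp: side_def)

lemma side_pos_Suc:
  "side s (pos c (Suc n)) = side s (pos c n) +
     (if c (pos c n) (cnt c n (pos c n)) = s then 1 else -1)"
  by (auto simp: side_def pos_Suc)

section \<open>Edge crossings and the generation process\<close>

definition outs :: "bool \<Rightarrow> (int \<Rightarrow> nat \<Rightarrow> bool) \<Rightarrow> nat \<Rightarrow> nat \<Rightarrow> nat" where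
  "outs s c n k = heads (row s c k) (cnt c n (side s (int k)))"

definition backs :: "bool \<Rightarrow> (int \<Rightarrow> nat \<Rightarrow> bool) \<Rightarrow> nat \<Rightarrow> nat \<Rightarrow> nat" where
  "backs s c n k = tails (row s c k) (cnt c n (side s (int k)))"

lemma outs_Suc:
  "outs s c (Suc n) k = outs s c n k +
    (if side s (pos c n) = int k \<and> row s c k (cnt c n (side s (int k))) then 1 else 0)"
  by (auto simp: outs_def cnt_Suc side_eq_iff)

lemma backs_Suc:
  "backs s c (Suc n) k = backs s c n k +
    (if side s (pos c n) = int k \<and> \<not> row s c k (cnt c n (side s (int k))) then 1 else 0)"
  by (auto simp: backs_def cnt_Suc side_eq_iff)

lemma outs_0 [simp]: "outs s c 0 k = 0" and backs_0 [simp]: "backs s c 0 k = 0"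
  by (auto simp: outs_def backs_def)

text \<open>The walk starts at 0 and moves to neighbours only, so crossings of the edge between
  \<open>k\<close> and \<open>Suc k\<close> alternate, beginning outward; the extra term is an
  outward crossing not yet undone.\<close>

lemma flow:
  "outs s c n k = backs s c n (Suc k) + (if int k < side s (pos c n) then 1 else 0)"
proof (induction n)
  case 0
  then show ?case by (simp add: side_def)
next
  case (Suc n)
  let ?p = "side s (pos c n)"
  have row: "row s c j (cnt c n (side s (int j))) \<longleftrightarrow> c (pos c n) (cnt c n (pos c n)) = s"
    if "?p = int j" for j
    unfolding that[symmetric] row_def by simp
  consider "?p = int k" | "?p = int (Suc k)" | "?p < int k" | "?p > int (Suc k)" by linarith
  then show ?case
    by cases (use Suc row[of k] row[of "Suc k"] in \<open>auto simp: outs_Suc backs_Suc side_pos_Suc\<close>)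
qed

text \<open>Every outward step to a site must be undone by a failure there, so one generation
  prescribes the failures at the next site. Rows enter from site 1 on; the tosses at 0 are
  summarised by \<open>m\<close>.\<close>

primrec gens :: "bool \<Rightarrow> (int \<Rightarrow> nat \<Rightarrow> bool) \<Rightarrow> nat \<Rightarrow> nat \<Rightarrow> nat" where
  "gens s c m 0 = m"
| "gens s c m (Suc k) = progeny (gens s c m k) (row s c (Suc k))"

text \<open>Induction on time. Only an outward step from \<open>k\<close> could break the bound; at
  that moment \<open>flow\<close> shows that fewer failures have occurred at \<open>k\<close> than
  the previous generation demands, so this success is counted by \<open>progeny\<close>.\<close>

lemma outs_le_gens:
  assumes reach: "\<And>k m. reaches m (row s c k)"
    and "outs s c n 0 \<le> m"
  shows "outs s c n k \<le> gens s c m k"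
  using assms(2)
proof (induction n arbitrary: k)
  case (Suc n)
  then have le: "outs s c n 0 \<le> m" by (simp add: outs_Suc)
  show ?case
  proof (cases k)
    case 0
    with Suc show ?thesis by simp
  next
    case k: (Suc j)
    let ?N = "cnt c n (side s (int k))"
    show ?thesis
    proof (cases "side s (pos c n) = int k \<and> row s c k ?N")
      case False
      with Suc.IH[OF le, of k] show ?thesis by (auto simp: outs_Suc)
    next
      case True
      have "outs s c n j = backs s c n k + 1"
        using flow[of s c n j] True k by simp
      \<comment> \<open>Toss \<open>?N\<close> is a success, so \<open>tails\<close> takes the same
        value at \<open>Suc ?N\<close> as at \<open>?N\<close>.\<close>
      then have "tails (row s c k) (Suc ?N) < gens s c m j"
        using Suc.IH[OF le, of j] True by (simp add: backs_def)
      from heads_le_progeny[OF reach this] show ?thesis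
        using True k unfolding outs_Suc by (simp add: outs_def)
    qed
  qed
qed simp

lemma bounded_of_extinct:
  assumes reach: "\<And>k m. reaches m (row s c k)"
    and "\<And>n. outs s c n 0 \<le> m" "gens s c m K = 0"
  shows "side s (pos c n) \<le> int K"
proof (rule ccontr)
  assume "\<not> ?thesis"
  then have "outs s c n K \<noteq> 0"
    using flow[of s c n K] by simp
  with outs_le_gens[OF reach assms(2), of n K] assms(3) show False
    by simp
qed

section \<open>Deterministic criteria for recurrence and transience\<close>

definition good_rows :: "(int \<Rightarrow> nat \<Rightarrow> bool) \<Rightarrow> bool" where
  "good_rows c \<longleftrightarrow> (\<forall>s z m. reaches m (\<lambda>i. c z i = s))"

lemma good_rows_row: "good_rows c \<Longrightarrow> reaches m (row s c k)"
  by (simp add: good_rows_def row_def)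

text \<open>A success for \<open>s\<close> is a failure for the opposite flag, and
  \<open>good_rows\<close> covers both flags.\<close>

lemma good_rows_heads:
  assumes "good_rows c"
  shows "\<exists>N. m \<le> heads (\<lambda>i. c z i = s) N"
proof -
  have "(\<lambda>i. \<not> (c z i = (\<not> s))) = (\<lambda>i. c z i = s)" by auto
  moreover have "reaches m (\<lambda>i. c z i = (\<not> s))"
    using assms unfolding good_rows_def by blast
  ultimately show ?thesis
    by (simp add: reaches_def tails_def)
qed

text \<open>The converse of \<open>outs_le_gens\<close>, at a time when the walk is at 0: the extra
  term in \<open>flow\<close> vanishes, all outward steps have been undone, and each site has seen
  at least the required failures.\<close>

lemma gens_extinct:
  assumes good: "good_rows c" and inf: "infinite {n. pos c n = 0}"
  shows "\<exists>K. gens s c m K = 0"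
proof -
  obtain N where N: "m \<le> heads (row s c 0) N"
    using good_rows_heads[OF good] unfolding row_def by blast
  obtain n0 where n0: "N \<le> cnt c n0 0"
    using cnt_unbounded[OF inf] by auto
  obtain n where n: "n0 \<le> n" "pos c n = 0"
    using inf unfolding infinite_nat_iff_unbounded_le by blast
  have "gens s c m k \<le> outs s c n k" for k
  proof (induction k)
    case 0
    have "N \<le> cnt c n 0"
      using n0 n(1) monoD[OF mono_cnt, of n0 n c 0] by simp
    then show ?case
      using N monoD[OF mono_heads, of N "cnt c n 0" "row s c 0"]
      by (simp add: outs_def)
  next
    case (Suc k)
    then have "gens s c m k \<le> backs s c n (Suc k)"
      using flow[of s c n k] n(2) by simp
    then show ?case
      by (auto simp: outs_def backs_def intro: progeny_le_heads)
  qed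
  \<comment> \<open>Site \<open>n\<close> cannot have been left before time \<open>n\<close>, so no
    outward step is recorded there.\<close>
  from this[of n] have "gens s c m n = 0"
    by (simp add: outs_def cnt_outside side_def)
  then show ?thesis ..
qed

text \<open>Infinitely many visits to \<open>x\<close> use up all coins at \<open>x\<close>, and a
  good row contains each outcome arbitrarily late.\<close>

lemma visits_neighbour:
  assumes good: "good_rows c" and inf: "infinite {n. pos c n = x}"
  shows "infinite {n. pos c n = x + side s 1}"
  unfolding infinite_nat_iff_unbounded_le
proof
  fix n0
  let ?b = "\<lambda>i. c x i = s"
  have "\<exists>n\<ge>n0. pos c n = x \<and> ?b (cnt c n x)"
  proof (rule ccontr)
    assume neg: "\<not> ?thesis"
    have const: "heads ?b (cnt c (n0 + j) x) = heads ?b (cnt c n0 x)" for j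
      by (induction j) (use neg in \<open>auto simp: cnt_Suc\<close>)
    obtain N where N: "Suc (heads ?b (cnt c n0 x)) \<le> heads ?b N"
      using good_rows_heads[OF good] by blast
    obtain n where n: "N \<le> cnt c n x"
      using cnt_unbounded[OF inf] by auto
    have "heads ?b N \<le> heads ?b (cnt c (n0 + n) x)"
      using n monoD[OF mono_cnt, of n "n0 + n" c x] by (intro monoD[OF mono_heads]) simp
    with const N show False by simp
  qed
  then obtain n where "n \<ge> n0" "pos c n = x" "?b (cnt c n x)" by auto
  then have "Suc n \<ge> n0 \<and> pos c (Suc n) = x + side s 1"
    by (auto simp: pos_Suc side_def)
  then show "\<exists>n\<ge>n0. n \<in> {n. pos c n = x + side s 1}" by (auto intro!: exI[of _ "Suc n"])
qed

lemma visits_everywhere: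
  assumes good: "good_rows c" and inf: "infinite {n. pos c n = x}"
  shows "infinite {n. pos c n = y}"
proof -
  have right: "infinite {n. pos c n = x + int k}" for k
  proof (induction k)
    case (Suc k)
    from visits_neighbour[OF good this, of True] show ?case
      by (simp add: side_def algebra_simps)
  qed (use inf in simp)
  have left: "infinite {n. pos c n = x - int k}" for k
  proof (induction k)
    case (Suc k)
    from visits_neighbour[OF good this, of False] show ?case
      by (simp add: side_def algebra_simps)
  qed (use inf in simp)
  have "y = x + int (nat (y - x)) \<or> y = x - int (nat (x - y))" by linarith
  with right left show ?thesis by metis
qed

text \<open>The number of visits to 0 bounds the outward steps from 0 and can therefore serve as the
  initial generation.\<close>

lemma finite_visits_bounded:
  assumes good: "good_rows c" and fin: "finite {n. pos c n = 0}"
    and ext: "\<And>m. \<exists>K. gens s c m K = 0"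
  shows "\<exists>K. \<forall>n. side s (pos c n) \<le> int K"
proof -
  have "outs s c n 0 \<le> card {n. pos c n = 0}" for n
  proof -
    have "cnt c n 0 \<le> card {n. pos c n = 0}"
      unfolding cnt_eq_card by (intro card_mono fin) auto
    then show ?thesis
      using heads_le[of "row s c 0" "cnt c n 0"] by (simp add: outs_def)
  qed
  with bounded_of_extinct[OF good_rows_row[OF good]] ext[of "card {n. pos c n = 0}"]
  show ?thesis by blast
qed

text \<open>Otherwise the walk stays in a finite interval, some site there is visited infinitely
  often, and this property spreads to 0.\<close>

lemma recurrent_of_extinct:
  assumes good: "good_rows c" and ext: "\<And>s m. \<exists>K. gens s c m K = 0"
  shows "infinite {n. pos c n = 0}"
proof
  assume fin: "finite {n. pos c n = 0}"
  obtain K K' where K: "\<forall>n. pos c n \<le> int K" and K': "\<forall>n. - pos c n \<le> int K'"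
    using finite_visits_bounded[OF good fin ext, of True]
      finite_visits_bounded[OF good fin ext, of False] by (auto simp: side_def)
  have "UNIV = (\<Union>x\<in>{-int K'..int K}. {n. pos c n = x})"
    using K K' by (auto simp: minus_le_iff)
  then have "infinite (\<Union>x\<in>{-int K'..int K}. {n. pos c n = x})"
    using infinite_UNIV_nat by simp
  then obtain x where "infinite {n. pos c n = x}" by blast
  from visits_everywhere[OF good this] fin show False by auto
qed

text \<open>Survival excludes infinitely many visits to 0, hence to any site; extinction on the
  other side bounds the walk there. Only finitely many times remain below any given level.\<close>

lemma transient_of_survival:
  assumes good: "good_rows c"
    and ext: "\<And>m. \<exists>K. gens (\<not> s) c m K = 0" and surv: "\<And>K. gens s c m K \<noteq> 0"
  shows "filterlim (\<lambda>n. side s (pos c n)) at_top sequentially"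
proof -
  have fin0: "finite {n. pos c n = 0}"
    using gens_extinct[OF good] surv by blast
  then have fin: "finite {n. pos c n = x}" for x
    using visits_everywhere[OF good] by blast
  obtain K where "\<forall>n. side (\<not> s) (pos c n) \<le> int K"
    using finite_visits_bounded[OF good fin0 ext] by auto
  then have K: "- int K \<le> side s (pos c n)" for n
    by (auto simp: side_def minus_le_iff split: if_splits)
  have "\<forall>\<^sub>F n in sequentially. B \<le> side s (pos c n)" for B
  proof -
    have "{n. \<not> B \<le> side s (pos c n)} \<subseteq> (\<Union>x\<in>{-int K..<B}. {n. pos c n = side s x})"
      using K by (force simp: side_eq_iff)
    then have "finite {n. \<not> B \<le> side s (pos c n)}"
      using fin by (auto intro: finite_subset)
    then show ?thesis
      by (simp add: eventually_cofinite flip: cofinite_eq_sequentially)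
  qed
  then show ?thesis by (simp add: filterlim_at_top)
qed

section \<open>Offspring distribution of one site\<close>

definition unif :: "real measure" where
  "unif = uniform_measure lborel {0..1}"

lemma sets_unif [measurable_cong, simp]: "sets unif = sets borel"
  by (simp add: unif_def)

lemma space_unif [simp]: "space unif = UNIV"
  by (simp add: unif_def)

lemma prob_space_unif: "prob_space unif"
  unfolding unif_def by (rule prob_space_uniform_measure) auto

lemma emeasure_unif_less:
  assumes "p \<in> {0..1}"
  shows "emeasure unif {x. x < p} = ennreal p"
proof -
  have "{0..1} \<inter> {x. x < p} = {0..<p}" using assms by auto
  moreover have "emeasure unif {x. x < p} =
      emeasure lborel ({0..1} \<inter> {x. x < p}) / emeasure lborel {0..1::real}"
    unfolding unif_def by (rule emeasure_uniform_measure) measurable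
  ultimately show ?thesis
    using assms by (simp add: divide_ennreal_def)
qed

definition pr :: "bool \<Rightarrow> real \<Rightarrow> real" where
  "pr s p = (if s then p else 1 - p)"

lemma pr_bounds: "p \<in> {0..1} \<Longrightarrow> pr s p \<in> {0..1}"
  by (auto simp: pr_def)

lemma emeasure_unif_coin:
  assumes "p \<in> {0..1}"
  shows "emeasure unif {x. (x < p) = s} = ennreal (pr s p)"
proof (cases s)
  case True
  with emeasure_unif_less[OF assms] show ?thesis by (simp add: pr_def)
next
  case False
  interpret prob_space unif by (rule prob_space_unif)
  have "emeasure unif (space unif - {x. x < p}) = 1 - ennreal p"
    using emeasure_unif_less[OF assms]
    by (subst emeasure_compl) (auto simp: emeasure_space_1[simplified])
  moreover have "space unif - {x. x < p} = {x. (x < p) = s}" using False by auto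
  ultimately show ?thesis using assms False by (simp add: pr_def ennreal_minus flip: ennreal_1)
qed

abbreviation rows :: "(nat \<Rightarrow> real) measure" where
  "rows \<equiv> (\<Pi>\<^sub>M i\<in>(UNIV :: nat set). unif)"

lemma prob_space_rows: "prob_space rows"
  by (intro prob_space_PiM prob_space_unif)

definition coins :: "bool \<Rightarrow> (nat \<Rightarrow> real) \<Rightarrow> (nat \<Rightarrow> real) \<Rightarrow> nat \<Rightarrow> bool" where
  "coins s \<theta> u i \<longleftrightarrow> (u i < \<theta> (Suc i)) = s"

lemma measurable_heads [measurable]:
  assumes [measurable]: "\<And>i. Measurable.pred X (\<lambda>x. B x i)"
  shows "(\<lambda>x. heads (B x) N) \<in> measurable X (count_space UNIV)"
  by (induction N) simp_all

lemma measurable_tails [measurable]: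
  assumes [measurable]: "\<And>i. Measurable.pred X (\<lambda>x. B x i)"
  shows "(\<lambda>x. tails (B x) N) \<in> measurable X (count_space UNIV)"
  unfolding tails_def by measurable

lemma measurable_reaches [measurable]:
  assumes [measurable]: "\<And>i. Measurable.pred X (\<lambda>x. B x i)"
  shows "Measurable.pred X (\<lambda>x. reaches m (B x))"
  unfolding reaches_def by measurable

lemma measurable_progeny [measurable]:
  assumes [measurable]: "\<And>i. Measurable.pred X (\<lambda>x. B x i)"
  shows "(\<lambda>x. progeny m (B x)) \<in> measurable X (count_space UNIV)"
  unfolding progeny_def
  by (rule measurable_compose_countable[where g = "\<lambda>x. LEAST N. m \<le> tails (B x) N"]) measurable

text \<open>The value 0 when the \<open>m\<close>-th failure never comes keeps the first-toss
  recursion exact. At \<open>a = 1\<close> the integral is the probability that the failure does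
  come.\<close>

definition wgt :: "real \<Rightarrow> nat \<Rightarrow> (nat \<Rightarrow> bool) \<Rightarrow> ennreal" where
  "wgt a m b = (if reaches m b then ennreal (a ^ progeny m b) else 0)"

lemma measurable_wgt [measurable]:
  assumes [measurable]: "\<And>i. Measurable.pred X (\<lambda>x. B x i)"
  shows "(\<lambda>x. wgt a m (B x)) \<in> borel_measurable X"
  unfolding wgt_def by measurable

lemma wgt_0 [simp]: "wgt a 0 b = 1"
  by (simp add: wgt_def)

lemma wgt_Suc:
  assumes "0 \<le> a"
  shows "wgt a (Suc m) b =
    (if b 0 then ennreal a * wgt a (Suc m) (\<lambda>i. b (Suc i)) else wgt a m (\<lambda>i. b (Suc i)))"
proof (cases "reaches (Suc m) b")
  case True
  with reaches_Suc_shift[of m b] show ?thesis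
    using assms by (cases "b 0") (simp_all add: wgt_def progeny_Suc_shift[OF True] ennreal_mult)
next
  case False
  with reaches_Suc_shift[of m b] show ?thesis
    by (cases "b 0") (simp_all add: wgt_def)
qed

lemma wgt_le_1: "0 \<le> a \<Longrightarrow> a \<le> 1 \<Longrightarrow> wgt a m b \<le> 1"
  by (simp add: wgt_def power_le_one)

definition site_gf :: "bool \<Rightarrow> real \<Rightarrow> (nat \<Rightarrow> real) \<Rightarrow> nat \<Rightarrow> ennreal" where
  "site_gf s a \<theta> m = (\<integral>\<^sup>+u. wgt a m (coins s \<theta> u) \<partial>rows)"

lemma pred_coins [measurable]: "Measurable.pred rows (\<lambda>u. coins s \<theta> u i)"
  unfolding coins_def by measurable

lemma site_gf_0 [simp]: "site_gf s a \<theta> 0 = 1"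
proof -
  interpret prob_space rows by (rule prob_space_rows)
  show ?thesis by (simp add: site_gf_def emeasure_space_1)
qed

lemma site_gf_le_1: "0 \<le> a \<Longrightarrow> a \<le> 1 \<Longrightarrow> site_gf s a \<theta> m \<le> 1"
proof -
  assume a: "0 \<le> a" "a \<le> 1"
  interpret prob_space rows by (rule prob_space_rows)
  have "site_gf s a \<theta> m \<le> (\<integral>\<^sup>+u. 1 \<partial>rows)"
    unfolding site_gf_def using a by (intro nn_integral_mono wgt_le_1)
  then show ?thesis by (simp add: emeasure_space_1)
qed

text \<open>The first uniform variable is split off; the others form an independent row again,
  facing the environment shifted by one cookie.\<close>

lemma site_gf_Suc:
  assumes a: "0 \<le> a" and \<theta>: "\<theta> 1 \<in> {0..1}"
  shows "site_gf s a \<theta> (Suc m) =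
    ennreal (pr s (\<theta> 1)) * (ennreal a * site_gf s a (\<lambda>i. \<theta> (Suc i)) (Suc m)) +
    ennreal (pr (\<not> s) (\<theta> 1)) * site_gf s a (\<lambda>i. \<theta> (Suc i)) m"
proof -
  interpret U: prob_space unif by (rule prob_space_unif)
  interpret sequence_space unif ..
  let ?\<theta> = "\<lambda>i. \<theta> (Suc i)"
  let ?A = "\<lambda>s. {x. (x < \<theta> 1) = s}"
  have shift: "(\<lambda>i. coins s \<theta> (case_nat x u) (Suc i)) = coins s ?\<theta> u" for x u
    by (auto simp: coins_def fun_eq_iff)
  have "site_gf s a \<theta> (Suc m) =
      (\<integral>\<^sup>+u. wgt a (Suc m) (coins s \<theta> u) \<partial>distr (unif \<Otimes>\<^sub>M rows) rows (\<lambda>(x, u). case_nat x u))"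
    unfolding site_gf_def PiM_iter ..
  also have "\<dots> = (\<integral>\<^sup>+(x, u). wgt a (Suc m) (coins s \<theta> (case_nat x u)) \<partial>(unif \<Otimes>\<^sub>M rows))"
    by (subst nn_integral_distr) (auto simp: split_beta')
  also have "\<dots> = (\<integral>\<^sup>+x. \<integral>\<^sup>+u. wgt a (Suc m) (coins s \<theta> (case_nat x u)) \<partial>rows \<partial>unif)"
  proof (subst P.nn_integral_fst[symmetric])
    have [measurable]: "Measurable.pred (unif \<Otimes>\<^sub>M rows) (\<lambda>x. coins s \<theta> (case_nat (fst x) (snd x)) i)" for i
      unfolding coins_def by (cases i) simp_all
    show "(\<lambda>(x, u). wgt a (Suc m) (coins s \<theta> (case_nat x u))) \<in> borel_measurable (unif \<Otimes>\<^sub>M rows)"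
      unfolding split_beta' by measurable
  qed simp
  also have "\<dots> = (\<integral>\<^sup>+x. (ennreal a * site_gf s a ?\<theta> (Suc m)) * indicator (?A s) x +
      site_gf s a ?\<theta> m * indicator (?A (\<not> s)) x \<partial>unif)"
  proof (intro nn_integral_cong)
    fix x
    show "(\<integral>\<^sup>+u. wgt a (Suc m) (coins s \<theta> (case_nat x u)) \<partial>rows) =
      (ennreal a * site_gf s a ?\<theta> (Suc m)) * indicator (?A s) x +
      site_gf s a ?\<theta> m * indicator (?A (\<not> s)) x"
      by (subst wgt_Suc[OF a], unfold shift site_gf_def, cases "(x < \<theta> 1) = s")
         (auto simp: coins_def nn_integral_cmult)
  qed
  also have "\<dots> = (ennreal a * site_gf s a ?\<theta> (Suc m)) * emeasure unif (?A s) +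
      site_gf s a ?\<theta> m * emeasure unif (?A (\<not> s))"
    by (subst nn_integral_add) (auto simp: nn_integral_cmult_indicator)
  finally show ?thesis
    unfolding emeasure_unif_coin[OF \<theta>] by (simp add: mult_ac)
qed

lemma pr_neg: "pr (\<not> s) p = 1 - pr s p"
  by (simp add: pr_def)

text \<open>The fair environment is invariant under the shift, so \<open>site_gf_Suc\<close> becomes
  a linear equation between the values at \<open>Suc m\<close> and \<open>m\<close>.\<close>

lemma site_gf_fair:
  assumes a: "0 \<le> a" "a \<le> 1" and \<theta>: "\<And>i. i \<ge> 1 \<Longrightarrow> \<theta> i = 1 / 2"
  shows "site_gf s a \<theta> m = ennreal (1 / (2 - a) ^ m)"
proof (induction m)
  case (Suc m)
  have "coins s (\<lambda>i. \<theta> (Suc i)) u = coins s \<theta> u" for u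
    by (simp add: coins_def fun_eq_iff \<theta>)
  then have same: "site_gf s a (\<lambda>i. \<theta> (Suc i)) m' = site_gf s a \<theta> m'" for m'
    by (simp add: site_gf_def)
  \<comment> \<open>The unknown occurs on both sides of the equation; being finite, it can be solved
    for in the reals.\<close>
  obtain x where x: "x \<ge> 0" "site_gf s a \<theta> (Suc m) = ennreal x"
    using site_gf_le_1[OF a, of s \<theta> "Suc m"]
    by (metis ennreal_cases ennreal_one_neq_top top.extremum_unique)
  have comb: "ennreal p * (ennreal a * ennreal x) + ennreal p * ennreal y =
      ennreal (p * (a * x) + p * y)" if "0 \<le> p" "0 \<le> y" for p y
    using a x that by (simp flip: ennreal_mult ennreal_plus)
  have half: "pr s' (\<theta> 1) = 1 / 2" for s'
    using \<theta>[of 1] by (simp add: pr_def)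
  have "ennreal x = ennreal (1 / 2) * (ennreal a * ennreal x) +
      ennreal (1 / 2) * ennreal (1 / (2 - a) ^ m)"
    using site_gf_Suc[of a \<theta> s m] a(1) x(2) \<theta>[of 1]
    unfolding half same Suc by simp
  also have "\<dots> = ennreal (1 / 2 * (a * x) + 1 / 2 * (1 / (2 - a) ^ m))"
    by (rule comb) (use a in auto)
  finally have "ennreal x = ennreal (1 / 2 * (a * x) + 1 / 2 * (1 / (2 - a) ^ m))" .
  then have "x = 1 / 2 * (a * x) + 1 / 2 * (1 / (2 - a) ^ m)"
    using a x by (subst (asm) ennreal_inj) auto
  then have "x * (2 - a) = 1 / (2 - a) ^ m" by (simp add: algebra_simps)
  then have "x = 1 / (2 - a) ^ Suc m"
    using a by (simp add: field_simps)
  with x show ?case by simp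
qed simp

text \<open>Every unused fair coin contributes \<open>1 / (2 - a)\<close> per failure; the assumption \<open>M \<le> m\<close> ensures
  that all cookies are consumed before the \<open>m\<close>-th failure.\<close>

lemma site_gf:
  assumes a: "0 \<le> a" "a \<le> 1"
    and "\<And>i. i \<ge> 1 \<Longrightarrow> \<theta> i \<in> {0..1}" "\<And>i. i > M \<Longrightarrow> \<theta> i = 1 / 2" "M \<le> m"
  shows "site_gf s a \<theta> m =
    ennreal ((\<Prod>i=1..M. 1 - (2 * pr s (\<theta> i) - 1) * (1 - a)) / (2 - a) ^ m)"
  using assms(3-)
proof (induction M arbitrary: \<theta> m)
  case 0
  then show ?case using site_gf_fair[OF a, of \<theta> s m] by simp
next
  case (Suc M)
  then obtain m' where m: "m = Suc m'" "M \<le> m'" by (cases m) auto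
  let ?f = "\<lambda>i. 1 - (2 * pr s (\<theta> i) - 1) * (1 - a)"
  define R where "R = (\<Prod>i=1..M. ?f (Suc i))"
  have \<theta>1: "\<theta> 1 \<in> {0..1}" using Suc by simp
  have p: "pr s (\<theta> 1) \<in> {0..1}" by (rule pr_bounds[OF \<theta>1])
  have f_nonneg: "0 \<le> ?f i" if "i \<ge> 1" for i
  proof -
    have "pr s (\<theta> i) \<in> {0..1}" using Suc.prems(1)[OF that] by (rule pr_bounds)
    then have "(2 * pr s (\<theta> i) - 1) * (1 - a) \<le> 1 * 1" using a by (intro mult_mono) auto
    then show ?thesis by simp
  qed
  then have R: "0 \<le> R" unfolding R_def by (intro prod_nonneg) auto
  have IH: "site_gf s a (\<lambda>i. \<theta> (Suc i)) n = ennreal (R / (2 - a) ^ n)" if "M \<le> n" for n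
    unfolding R_def using Suc.prems that by (intro Suc.IH) auto
  have "site_gf s a \<theta> m = ennreal (pr s (\<theta> 1) * (a * (R / (2 - a) ^ Suc m')) +
      (1 - pr s (\<theta> 1)) * (R / (2 - a) ^ m'))"
    unfolding m(1) site_gf_Suc[where \<theta> = \<theta>, OF a(1) \<theta>1] using m(2) p a R
    by (simp add: IH pr_neg flip: ennreal_mult ennreal_plus)
  also have "pr s (\<theta> 1) * (a * (R / (2 - a) ^ Suc m')) + (1 - pr s (\<theta> 1)) * (R / (2 - a) ^ m') =
      ?f 1 * R / (2 - a) ^ m"
    using a by (simp add: m(1) field_simps)
  also have "?f 1 * R = (\<Prod>i=1..Suc M. ?f i)"
    unfolding R_def by (subst prod.atLeast_Suc_atMost) (simp_all add: prod.shift_bounds_cl_Suc_ivl del: prod.cl_ivl_Suc)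
  finally show ?case .
qed

text \<open>At \<open>a = 1\<close> the formula for \<open>site_gf\<close> evaluates to 1 and
  \<open>wgt\<close> is an indicator. The maximum with \<open>M\<close> makes the formula
  applicable.\<close>

lemma AE_reaches:
  assumes "\<And>i. i \<ge> 1 \<Longrightarrow> \<theta> i \<in> {0..1}" "\<And>i. i > M \<Longrightarrow> \<theta> i = 1 / 2"
  shows "AE u in rows. reaches m (coins s \<theta> u)"
proof -
  interpret prob_space rows by (rule prob_space_rows)
  have "(\<integral>\<^sup>+u. wgt 1 (max m M) (coins s \<theta> u) \<partial>rows) = 1"
    using site_gf[of 1 \<theta> M "max m M" s] assms by (simp add: site_gf_def)
  also have "(\<integral>\<^sup>+u. wgt 1 (max m M) (coins s \<theta> u) \<partial>rows) =
      (\<integral>\<^sup>+u. indicator {u \<in> space rows. reaches (max m M) (coins s \<theta> u)} u \<partial>rows)"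
    by (intro nn_integral_cong) (auto simp: wgt_def indicator_def)
  finally have "prob {u \<in> space rows. reaches (max m M) (coins s \<theta> u)} = 1"
    by (simp add: emeasure_eq_measure)
  then have "AE u in rows. reaches (max m M) (coins s \<theta> u)"
    by (subst (asm) prob_Collect_eq_1) auto
  then show ?thesis
    by eventually_elim (auto simp: reaches_def intro: le_trans[OF max.cobounded1])
qed

lemma progeny_gf:
  assumes "0 \<le> a" "a \<le> 1"
    and "\<And>i. i \<ge> 1 \<Longrightarrow> \<theta> i \<in> {0..1}" "\<And>i. i > M \<Longrightarrow> \<theta> i = 1 / 2" "M \<le> m"
  shows "(\<integral>\<^sup>+u. ennreal (a ^ progeny m (coins s \<theta> u)) \<partial>rows) =
    ennreal ((\<Prod>i=1..M. 1 - (2 * pr s (\<theta> i) - 1) * (1 - a)) / (2 - a) ^ m)"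
proof -
  have "(\<integral>\<^sup>+u. ennreal (a ^ progeny m (coins s \<theta> u)) \<partial>rows) = site_gf s a \<theta> m"
    unfolding site_gf_def using AE_reaches[where \<theta> = \<theta> and M = M and m = m and s = s, OF assms(3,4)]
    by (intro nn_integral_cong_AE) (auto simp: wgt_def)
  with site_gf[where \<theta> = \<theta>, OF assms] show ?thesis by simp
qed

section \<open>Lyapunov functions for the branching process\<close>

lemma suminf_Suc_le_ennreal:
  fixes g :: "nat \<Rightarrow> ennreal"
  shows "(\<Sum>t. g (Suc t)) \<le> (\<Sum>t. g t)"
proof -
  have "(\<Sum>t<n. g (Suc t)) \<le> (\<Sum>t. g t)" for n
  proof -
    have "(\<Sum>t<n. g (Suc t)) \<le> (\<Sum>t<Suc n. g t)"
      by (subst sum.lessThan_Suc_shift) simp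
    also have "\<dots> \<le> (\<Sum>t. g t)" by (intro sum_le_suminf) auto
    finally show ?thesis .
  qed
  then show ?thesis by (simp add: suminf_eq_SUP SUP_least)
qed

text \<open>Summation by parts compares partial sums rather than terms.\<close>

lemma suminf_le_partial_ennreal:
  fixes g h :: "nat \<Rightarrow> ennreal"
  assumes "\<And>n. (\<Sum>t<n. g t) \<le> (\<Sum>t<n. h t)"
  shows "(\<Sum>t. g t) \<le> (\<Sum>t. h t)"
  unfolding suminf_eq_SUP by (rule SUP_mono) (use assms in blast)

definition quot :: "nat \<Rightarrow> real" where
  "quot t = real t / (real t + 1)"

lemma quot_bounds: "0 \<le> quot t" "quot t < 1"
  by (auto simp: quot_def)

lemma quot_power_le: "quot t ^ v \<le> 1"
  using quot_bounds[of t] by (intro power_le_one) auto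

text \<open>\<open>F m\<close> is the generation produced by \<open>m\<close> parents at one random
  site. The generating function is known only from \<open>M\<close> parents on, where all cookies
  are consumed. The expansion of the cookie factor \<open>\<rho>\<close> brings in the drift, and
  \<open>die\<close> is what ellipticity provides.\<close>

locale branching = prob_space N for N :: "'c measure" +
  fixes F :: "nat \<Rightarrow> 'c \<Rightarrow> nat" and M :: nat and \<rho> :: "real \<Rightarrow> real" and \<delta> C :: real
  assumes F_measurable [measurable]: "\<And>m. F m \<in> measurable N (count_space UNIV)"
    and F_0: "\<And>w. F 0 w = 0"
    and gen: "\<And>m a. M \<le> m \<Longrightarrow> 0 \<le> a \<Longrightarrow> a \<le> 1 \<Longrightarrow>
      (\<integral>\<^sup>+w. ennreal (a ^ F m w) \<partial>N) = ennreal (\<rho> (1 - a) / (2 - a) ^ m)"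
    and rho: "\<And>x. 0 \<le> x \<Longrightarrow> x \<le> 1 \<Longrightarrow> \<bar>\<rho> x - (1 - \<delta> * x)\<bar> \<le> C * x\<^sup>2"
    and rho_nonneg: "\<And>x. 0 \<le> x \<Longrightarrow> x \<le> 1 \<Longrightarrow> 0 \<le> \<rho> x"
    and die: "\<And>m. 0 < emeasure N {w \<in> space N. F m w = 0}"
begin

section \<open>Transition operator, test functions and extinction probability\<close>

definition T :: "(nat \<Rightarrow> ennreal) \<Rightarrow> nat \<Rightarrow> ennreal" where
  "T u m = (\<integral>\<^sup>+w. u (F m w) \<partial>N)"

lemma T_mono: "(\<And>v. u v \<le> u' v) \<Longrightarrow> T u m \<le> T u' m"
  unfolding T_def by (intro nn_integral_mono) auto

lemma T_const: "T (\<lambda>_. c) m = c"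
  unfolding T_def by (simp add: emeasure_space_1)

lemma T_0: "T u 0 = u 0"
  unfolding T_def by (simp add: F_0 emeasure_space_1)

lemma T_cmult: "T (\<lambda>v. c * u v) m = c * T u m"
  unfolding T_def by (intro nn_integral_cmult) measurable

lemma T_add: "T (\<lambda>v. u v + u' v) m = T u m + T u' m"
  unfolding T_def by (intro nn_integral_add) measurable

lemma T_suminf: "T (\<lambda>v. \<Sum>t. u t v) m = (\<Sum>t. T (u t) m)"
  unfolding T_def by (intro nn_integral_suminf) measurable

lemma T_SUP:
  assumes "incseq u"
  shows "T (\<lambda>v. SUP k. u k v) m = (SUP k. T (u k) m)"
  unfolding T_def using assms
  by (intro nn_integral_monotone_convergence_SUP) (auto simp: incseq_def le_fun_def)

definition r :: "nat \<Rightarrow> real" where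
  "r t = \<rho> (1 / (real t + 1))"

lemma r_nonneg: "0 \<le> r t"
  unfolding r_def by (intro rho_nonneg) auto

lemma r_bound: "\<bar>r t - (1 - \<delta> / (real t + 1))\<bar> \<le> C / (real t + 1)\<^sup>2"
  using rho[of "1 / (real t + 1)"] by (simp add: r_def power_divide)

lemma C_nonneg: "0 \<le> C"
  using rho[of 1] by simp

text \<open>The fair offspring distribution acts on \<open>a\<close> by \<open>a \<mapsto> 1 / (2 - a)\<close>, which is the shift
  \<open>t \<mapsto> t + 1\<close> in the coordinate \<open>a = t / (t + 1)\<close>. So the test functions \<open>quot t ^ v\<close> are
  shifted up to the factors \<open>r t\<close>.\<close>

lemma T_quot:
  assumes "M \<le> m"
  shows "T (\<lambda>v. ennreal (quot t ^ v)) m = ennreal (r t * quot (Suc t) ^ m)"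
proof -
  have "1 - quot t = 1 / (real t + 1)" "2 - quot t = 1 / quot (Suc t)"
    by (auto simp: quot_def field_simps)
  then have "\<rho> (1 - quot t) / (2 - quot t) ^ m = r t * quot (Suc t) ^ m"
    by (simp add: r_def power_divide)
  with gen[OF assms, of "quot t"] quot_bounds[of t] show ?thesis
    by (simp add: T_def)
qed

lemma r_quot_le:
  assumes "M \<le> m"
  shows "r t * quot (Suc t) ^ m \<le> 1"
proof -
  have "T (\<lambda>v. ennreal (quot t ^ v)) m \<le> T (\<lambda>_. 1) m"
    by (intro T_mono) (simp add: quot_power_le)
  then show ?thesis by (simp add: T_quot[OF assms] T_const)
qed

text \<open>The finite term from \<open>T_quot\<close> is cancelled against the total mass 1, which
  avoids subtraction under the integral.\<close>

lemma T_compl_quot: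
  assumes "M \<le> m"
  shows "T (\<lambda>v. ennreal (1 - quot t ^ v)) m = ennreal (1 - r t * quot (Suc t) ^ m)"
proof -
  have "T (\<lambda>v. ennreal (1 - quot t ^ v) + ennreal (quot t ^ v)) m = T (\<lambda>_. 1) m"
    using quot_bounds[of t] quot_power_le[of t]
    by (intro arg_cong[where f = "\<lambda>u. T u m"]) (simp flip: ennreal_plus)
  then have eq: "T (\<lambda>v. ennreal (1 - quot t ^ v)) m + ennreal (r t * quot (Suc t) ^ m) = 1"
    by (simp add: T_add T_quot[OF assms] T_const)
  have "ennreal (1 - r t * quot (Suc t) ^ m) + ennreal (r t * quot (Suc t) ^ m) = 1"
    using r_quot_le[OF assms, of t] r_nonneg[of t] quot_bounds[of "Suc t"]
    by (simp flip: ennreal_plus)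
  with eq have "ennreal (r t * quot (Suc t) ^ m) + T (\<lambda>v. ennreal (1 - quot t ^ v)) m =
      ennreal (r t * quot (Suc t) ^ m) + ennreal (1 - r t * quot (Suc t) ^ m)"
    by (simp add: add.commute)
  then show ?thesis
    unfolding ennreal_add_left_cancel by simp
qed

text \<open>\<open>ext k m\<close> is the probability that the chain started from \<open>m\<close>
  is at 0 after \<open>k\<close> steps. As 0 is absorbing, this increases in \<open>k\<close> to the
  extinction probability \<open>h\<close>.\<close>

definition ext :: "nat \<Rightarrow> nat \<Rightarrow> ennreal" where
  "ext k = (T ^^ k) (\<lambda>v. if v = 0 then 1 else 0)"

lemma ext_simps: "ext 0 v = (if v = 0 then 1 else 0)" "ext (Suc k) = T (ext k)"
  by (auto simp: ext_def)

lemma ext_mono: "ext k v \<le> ext (Suc k) v"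
proof (induction k arbitrary: v)
  case 0
  show ?case by (simp add: ext_simps T_0)
next
  case (Suc k)
  then show ?case unfolding ext_simps(2)[of "Suc k"] ext_simps(2)[of k]
    by (intro T_mono) (simp add: ext_simps(2))
qed

definition h :: "nat \<Rightarrow> ennreal" where
  "h v = (SUP k. ext k v)"

lemma h_harmonic: "T h m = h m"
proof -
  have inc: "incseq ext"
    using ext_mono by (intro incseq_SucI) (simp add: le_fun_def)
  have "T h m = (SUP k. ext (Suc k) m)"
    unfolding h_def[abs_def] T_SUP[OF inc] by (simp add: ext_simps)
  also have "\<dots> = h m"
    unfolding h_def using inc
    by (intro antisym SUP_mono) (auto simp: le_fun_def intro: ext_mono)
  finally show ?thesis .
qed

lemma ext_0: "ext k 0 = 1"
  by (induction k) (simp_all add: ext_simps T_0)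

lemma h_0: "h 0 = 1"
  by (simp add: h_def ext_0)

text \<open>Strong minimum principle: by \<open>die\<close> the chain jumps from \<open>m\<close> to
  0 with positive probability, so a value above \<open>c\<close> at 0 would push the average
  \<open>T \<psi> m\<close> above \<open>c\<close>.\<close>

lemma minimum_at_0:
  assumes low: "\<And>v. c \<le> \<psi> v" and "T \<psi> m \<le> c" "c < \<top>"
  shows "\<psi> 0 \<le> c"
proof -
  let ?p = "emeasure N {w \<in> space N. F m w = 0}"
  have "c + (\<psi> 0 - c) * ?p = (\<integral>\<^sup>+w. c + (\<psi> 0 - c) * indicator {w \<in> space N. F m w = 0} w \<partial>N)"
    by (subst nn_integral_add) (auto simp: nn_integral_cmult emeasure_space_1)
  also have "\<dots> \<le> T \<psi> m"
    unfolding T_def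
    by (intro nn_integral_mono)
       (use low in \<open>auto simp: indicator_def add_diff_inverse_ennreal split: if_splits\<close>)
  also have "\<dots> \<le> c + 0" using assms(2) by simp
  finally have "(\<psi> 0 - c) * ?p \<le> 0"
    using assms(3) unfolding ennreal_add_left_cancel_le by auto
  then have "\<psi> 0 - c = 0" using die[of m] by auto
  then show ?thesis by (simp add: diff_eq_0_iff_ennreal)
qed

subsection \<open>Extinction\<close>

context
  assumes delta: "\<delta> \<le> 1"
begin

definition t0 :: nat where
  "t0 = Suc (nat \<lceil>C\<^sup>2 + C + 1\<rceil>)"

text \<open>Up to a shift this is \<open>1 / t + (C + 1) / t\<^sup>2\<close>: the sum of the weights diverges, that of
  \<open>wt t / t\<close> converges, and the second term absorbs the second order error in \<open>r\<close> at \<open>\<delta> = 1\<close>.\<close>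

definition wt :: "nat \<Rightarrow> real" where
  "wt t = (real (t + t0) + C + 1) / (real (t + t0))\<^sup>2"

definition lyap :: "nat \<Rightarrow> ennreal" where
  "lyap v = (\<Sum>t. ennreal (wt t * (1 - quot (t + t0) ^ v)))"

lemma t0: "1 \<le> t0" "C\<^sup>2 + C + 1 \<le> real t0"
  unfolding t0_def by linarith+

lemma wt_pos: "0 < wt t"
  using t0 C_nonneg by (auto simp: wt_def intro!: divide_pos_pos)

text \<open>This is the superharmonicity condition in terms of weights; the worst case is \<delta> =
  1. Strictness yields the gain that later pays for the boundary term.\<close>

lemma wt_decay: "wt (Suc t) < wt t * r (t + t0)"
proof -
  define s where "s = real (t + t0) + 1"
  have s: "s \<ge> 2" "s > C\<^sup>2 + C + 1"
    using t0 by (auto simp: s_def)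
  have "(s\<^sup>2 - s - C) / s\<^sup>2 = 1 - 1 / s - C / s\<^sup>2"
    using s by (simp add: field_simps power2_eq_square)
  also have "\<dots> \<le> 1 - \<delta> / s - C / s\<^sup>2"
    using s delta by (simp add: divide_right_mono)
  also have "\<dots> \<le> r (t + t0)"
    using r_bound[of "t + t0"] by (simp add: s_def add_ac abs_le_iff)
  finally have r: "(s\<^sup>2 - s - C) / s\<^sup>2 \<le> r (t + t0)" .
  \<comment> \<open>Cubic and quadratic terms cancel, and the correction \<open>C + 1\<close> in
    \<open>wt\<close> makes the linear coefficient 1; \<open>t0\<close> was chosen to make the
    remainder positive.\<close>
  have "(s - 1 + (C + 1)) * (s\<^sup>2 - s - C) - (s + (C + 1)) * (s - 1)\<^sup>2 = s - (C\<^sup>2 + C + 1)"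
    by (simp add: algebra_simps power2_eq_square)
  then have "(s + (C + 1)) * (s - 1)\<^sup>2 < (s - 1 + (C + 1)) * (s\<^sup>2 - s - C)"
    using s by linarith
  then have "s + (C + 1) < (s - 1 + (C + 1)) * (s\<^sup>2 - s - C) / (s - 1)\<^sup>2"
    using s by (subst pos_less_divide_eq) auto
  then have "(s + (C + 1)) / s\<^sup>2 < (s - 1 + (C + 1)) * (s\<^sup>2 - s - C) / (s - 1)\<^sup>2 / s\<^sup>2"
    using s by (intro divide_strict_right_mono) auto
  also have "\<dots> = (s - 1 + (C + 1)) / (s - 1)\<^sup>2 * ((s\<^sup>2 - s - C) / s\<^sup>2)"
    by simp
  also have "\<dots> \<le> (s - 1 + (C + 1)) / (s - 1)\<^sup>2 * r (t + t0)"
    using s C_nonneg by (intro mult_left_mono r) auto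
  finally show ?thesis
    by (simp add: wt_def s_def add_ac)
qed

lemma lyap_0: "lyap 0 = 0"
  by (simp add: lyap_def)

text \<open>Bernoulli's inequality gives a factor of order \<open>v / t\<close> and the weight is of
  order \<open>1 / t\<close>, so the terms are dominated by a multiple of
  \<open>1 / t\<^sup>2\<close>.\<close>

lemma lyap_finite: "lyap v < \<top>"
proof -
  have le: "wt t * (1 - quot (t + t0) ^ v) \<le> (C + 2) * real v * (1 / real (t + t0) ^ 2)" for t
  proof -
    let ?s = "real (t + t0)"
    have s: "?s \<ge> 1" using t0 by simp
    have "1 + real v * (quot (t + t0) - 1) \<le> (1 + (quot (t + t0) - 1)) ^ v"
      using quot_bounds[of "t + t0"] by (intro Bernoulli_inequality) simp
    then have "1 - quot (t + t0) ^ v \<le> real v * (1 - quot (t + t0))"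
      by (simp add: algebra_simps)
    also have "1 - quot (t + t0) = 1 / (?s + 1)"
      using s by (simp add: quot_def field_simps)
    also have "real v * (1 / (?s + 1)) \<le> real v * (1 / ?s)"
      using s by (intro mult_left_mono divide_left_mono) auto
    finally have "1 - quot (t + t0) ^ v \<le> real v * (1 / ?s)" .
    moreover have "wt t \<le> (C + 2) * (1 / ?s)"
    proof -
      have "?s + C + 1 \<le> (C + 2) * ?s"
        using s C_nonneg mult_left_mono[OF s C_nonneg] by (simp add: algebra_simps)
      then have "wt t \<le> (C + 2) * ?s / ?s\<^sup>2"
        unfolding wt_def by (intro divide_right_mono) (simp_all add: add_ac)
      then show ?thesis
        using s by (simp add: power2_eq_square)
    qed
    ultimately have "wt t * (1 - quot (t + t0) ^ v) \<le> (C + 2) * (1 / ?s) * (real v * (1 / ?s))"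
      using wt_pos[of t] quot_power_le[of "t + t0" v] C_nonneg s by (intro mult_mono) auto
    then show ?thesis by (simp add: power2_eq_square field_simps)
  qed
  have "summable (\<lambda>t. 1 / real (t + t0) ^ 2)"
    using inverse_power_summable[of 2, where 'a = real] 
    by (subst summable_iff_shift[of "\<lambda>t. 1 / real t ^ 2"]) (simp add: inverse_eq_divide)
  then have "summable (\<lambda>t. (C + 2) * real v * (1 / real (t + t0) ^ 2))"
    by (rule summable_mult)
  then have "summable (\<lambda>t. wt t * (1 - quot (t + t0) ^ v))"
    using le wt_pos quot_power_le
    by (rule_tac summable_comparison_test'[where N = 0 and g = "\<lambda>t. (C + 2) * real v * (1 / real (t + t0) ^ 2)"])
       (auto simp: abs_mult less_imp_le abs_of_nonneg)
  then have "lyap v = ennreal (\<Sum>t. wt t * (1 - quot (t + t0) ^ v))"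
    unfolding lyap_def using wt_pos quot_power_le by (intro suminf_ennreal2) (auto simp: less_imp_le)
  then show ?thesis by simp
qed

text \<open>The weights have a divergent sum, and in a fixed partial sum all powers of
  \<open>quot\<close> vanish as \<open>v\<close> grows.\<close>

lemma lyap_unbounded: "\<exists>n. \<forall>v\<ge>n. ennreal B < lyap v"
proof -
  have "\<not> summable (\<lambda>t. wt t)"
  proof
    assume "summable wt"
    then have "summable (\<lambda>t. 1 / real (t + t0))"
    proof (rule summable_comparison_test'[where N = 0])
      fix t :: nat
      have "real (t + t0) \<ge> 1" using t0 by simp
      moreover have "real (t + t0) / (real (t + t0))\<^sup>2 \<le> wt t"
        unfolding wt_def using C_nonneg by (intro divide_right_mono) auto
      ultimately show "norm (1 / real (t + t0)) \<le> wt t"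
        by (simp add: power2_eq_square)
    qed
    then have "summable (\<lambda>t. 1 / real t)"
      by (subst (asm) summable_iff_shift[of "\<lambda>t. 1 / real t"])
    then show False
      using not_summable_harmonic[where 'a = real] by (simp add: inverse_eq_divide)
  qed
  then obtain n where n: "B < (\<Sum>t<n. wt t)"
  proof -
    assume "\<not> summable (\<lambda>t. wt t)"
    moreover have "summable wt" if "\<And>n. (\<Sum>t<n. wt t) \<le> B"
      using that wt_pos by (intro summableI_nonneg_bounded[of _ B]) (auto simp: less_imp_le)
    ultimately show ?thesis using that by (meson not_le)
  qed
  have "(\<lambda>v. \<Sum>t<n. wt t * (1 - quot (t + t0) ^ v)) \<longlonglongrightarrow> (\<Sum>t<n. wt t * (1 - 0))"
    using quot_bounds by (intro tendsto_intros LIMSEQ_power_zero) auto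
  then have "eventually (\<lambda>v. B < (\<Sum>t<n. wt t * (1 - quot (t + t0) ^ v))) sequentially"
    using n by (intro order_tendstoD) auto
  then obtain n' where n': "\<And>v. v \<ge> n' \<Longrightarrow> B < (\<Sum>t<n. wt t * (1 - quot (t + t0) ^ v))"
    by (auto simp: eventually_sequentially)
  have "ennreal B < lyap v" if "v \<ge> max n' 1" for v
  \<comment> \<open>For \<open>n = 0\<close> the sum is empty, so \<open>B\<close> is negative and
    \<open>ennreal B\<close> is 0; strict inequality then needs one positive term, and
    \<open>v \<ge> 1\<close> supplies it.\<close>
  proof (cases "n = 0")
    case True
    have "0 < wt 0 * (1 - quot (0 + t0) ^ v)"
      using wt_pos[of 0] quot_bounds[of t0] that power_Suc_less_one[of "quot t0" "v - 1"]
        by (cases "quot t0 = 0") (auto simp: power_0_left)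
    then have "0 < ennreal (wt 0 * (1 - quot (0 + t0) ^ v))" by simp
    also have "\<dots> = (\<Sum>t<1. ennreal (wt t * (1 - quot (t + t0) ^ v)))" by simp
    also have "\<dots> \<le> lyap v" unfolding lyap_def by (intro sum_le_suminf) auto
    finally show ?thesis using n True by (simp add: ennreal_neg)
  next
    case False
    have pos: "0 \<le> wt t * (1 - quot (t + t0) ^ v)" for t
      using wt_pos[of t] quot_power_le[of "t + t0" v] by simp
    have "ennreal B < ennreal (\<Sum>t<n. wt t * (1 - quot (t + t0) ^ v))"
    proof -
      have "0 < (\<Sum>t<n. wt t * (1 - quot (t + t0) ^ v))"
      proof (rule sum_pos)
        fix t
        have "quot (t + t0) ^ v < 1"
          using quot_bounds[of "t + t0"] that by (intro power_less_one_iff[THEN iffD2]) auto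
        then show "0 < wt t * (1 - quot (t + t0) ^ v)" using wt_pos[of t] by simp
      qed (use False in auto)
      then show ?thesis using n'[of v] that by (simp add: ennreal_lessI)
    qed
    also have "\<dots> = (\<Sum>t<n. ennreal (wt t * (1 - quot (t + t0) ^ v)))"
      using pos by (simp add: sum_ennreal)
    also have "\<dots> \<le> lyap v" unfolding lyap_def by (intro sum_le_suminf) auto
    finally show ?thesis .
  qed
  then show ?thesis by blast
qed

text \<open>Summation by parts leaves a boundary term with the base \<open>quot t0\<close>; for large \<open>m\<close> it is beaten
  by the strict decrease \<open>D 0\<close>, which comes with the larger base \<open>quot (Suc t0)\<close>.\<close>

lemma lyap_super: "\<exists>K\<ge>M. \<forall>m\<ge>K. T lyap m \<le> lyap m"
proof -
  define D where "D t = wt t * r (t + t0) - wt (Suc t)" for t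
  have D: "0 < D t" for t using wt_decay[of t] by (simp add: D_def)
  have q1: "0 < quot t0" "quot t0 < quot (Suc t0)" using t0 by (auto simp: quot_def field_simps)
  have ratio: "1 < quot (Suc t0) / quot t0" using q1 by simp
  then obtain K where "wt 0 / D 0 < (quot (Suc t0) / quot t0) ^ K"
    using real_arch_pow by blast
  moreover have "(quot (Suc t0) / quot t0) ^ K \<le> (quot (Suc t0) / quot t0) ^ m" if "m \<ge> K" for m
    using ratio that by (intro power_increasing) auto
  ultimately have K: "wt 0 / D 0 \<le> (quot (Suc t0) / quot t0) ^ m" if "m \<ge> K" for m
    using that by (meson less_le_trans less_imp_le)
  have "T lyap m \<le> lyap m" if m: "m \<ge> max K M" for m
  proof -
    have mM: "M \<le> m" using m by simp
    have "wt 0 * quot t0 ^ m \<le> D 0 * quot (Suc t0) ^ m"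
      using K[of m] m q1 D[of 0] by (simp add: power_divide field_simps)
    then have base: "wt 0 * quot t0 ^ m - D 0 * quot (Suc t0) ^ m \<le> 0" by simp
    have part: "(\<Sum>t<n. wt t * (1 - r (t + t0) * quot (Suc (t + t0)) ^ m)) \<le>
        (\<Sum>t<n. wt t * (1 - quot (t + t0) ^ m))" for n
    proof (cases n)
      case (Suc j)
      \<comment> \<open>Summation by parts would be exact with all terms \<open>D t\<close>; only
        \<open>D 0\<close> is kept, the others being nonnegative.\<close>
      have "(\<Sum>t<Suc j. wt t * (1 - r (t + t0) * quot (Suc (t + t0)) ^ m)) -
          (\<Sum>t<Suc j. wt t * (1 - quot (t + t0) ^ m)) \<le>
          wt 0 * quot t0 ^ m - wt (Suc j) * quot (Suc j + t0) ^ m - D 0 * quot (Suc t0) ^ m"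
      proof (induction j)
        case 0
        show ?case by (simp add: D_def algebra_simps)
      next
        case (Suc j)
        have "0 \<le> D (Suc j) * quot (Suc (Suc j) + t0) ^ m"
          using D[of "Suc j"] quot_bounds by (intro mult_nonneg_nonneg zero_le_power) (auto simp: less_imp_le)
        with Suc show ?case by (simp add: D_def algebra_simps)
      qed
      also have "\<dots> \<le> 0"
        using base wt_pos[of "Suc j"] zero_le_power[OF quot_bounds(1), of "Suc j + t0" m]
        by (smt (verit) mult_nonneg_nonneg)
      finally show ?thesis using Suc by simp
    qed simp
    have "T lyap m = (\<Sum>t. ennreal (wt t) * T (\<lambda>v. ennreal (1 - quot (t + t0) ^ v)) m)"
      unfolding lyap_def[abs_def] T_suminf T_cmult[symmetric]
      using wt_pos quot_power_le by (simp add: ennreal_mult less_imp_le)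
    also have "\<dots> = (\<Sum>t. ennreal (wt t * (1 - r (t + t0) * quot (Suc (t + t0)) ^ m)))"
      using wt_pos r_quot_le[OF mM] by (simp add: T_compl_quot[OF mM] ennreal_mult less_imp_le)
    also have "\<dots> \<le> lyap m"
      unfolding lyap_def using part wt_pos r_quot_le[OF mM] quot_power_le
      by (intro suminf_le_partial_ennreal) (simp add: sum_ennreal less_imp_le sum_nonneg)
    finally show ?thesis .
  qed
  then show ?thesis by (intro exI[of _ "max K M"]) auto
qed

text \<open>Minimum principle: \<open>h + \<epsilon> * lyap\<close> tends to infinity and is superharmonic beyond \<open>K\<close>, so its
  values are bounded below by the minimum of \<open>h\<close> on \<open>{..K}\<close>; then let \<open>\<epsilon>\<close> tend to 0.\<close>

lemma h_eq_1: "h n = 1"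
proof -
  obtain K where K: "\<And>m. m \<ge> K \<Longrightarrow> T lyap m \<le> lyap m"
    using lyap_super by blast
  define s where "s = Min (h ` {..K})"
  have s_le: "s \<le> h m" if "m \<le> K" for m
    using that unfolding s_def by (intro Min_le) auto
  have "s \<in> h ` {..K}" unfolding s_def by (intro Min_in) auto
  then obtain m1 where m1: "s = h m1" by auto
  have s1: "s \<le> 1" using s_le[of 0] by (simp add: h_0)
  have below: "s \<le> h v + ennreal \<epsilon> * lyap v" if "\<epsilon> > 0" for \<epsilon> v
  proof (rule ccontr)
    define \<psi> where "\<psi> v = h v + ennreal \<epsilon> * lyap v" for v
    define S where "S = {v. \<psi> v < s}"
    assume "\<not> ?thesis"
    then have ne: "S \<noteq> {}" by (auto simp: S_def \<psi>_def not_le)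
    \<comment> \<open>From \<open>n\<close> on, \<open>\<epsilon> * lyap\<close> alone is at least 1
      and hence at least \<open>s\<close>; so \<open>S\<close> is finite and a minimum of \<psi> is
      attained.\<close>
    obtain n where n: "\<And>v. v \<ge> n \<Longrightarrow> ennreal (1 / \<epsilon>) < lyap v"
      using lyap_unbounded by blast
    have "S \<subseteq> {..<n}"
    proof
      fix v assume v: "v \<in> S"
      show "v \<in> {..<n}"
      proof (rule ccontr)
        assume "v \<notin> {..<n}"
        then have "ennreal (1 / \<epsilon>) \<le> lyap v" using n[of v] by simp
        then have "ennreal \<epsilon> * ennreal (1 / \<epsilon>) \<le> ennreal \<epsilon> * lyap v"
          by (rule mult_left_mono) simp
        then have "1 \<le> ennreal \<epsilon> * lyap v"
          using that by (simp flip: ennreal_mult)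
        also have "\<dots> \<le> \<psi> v" by (simp add: \<psi>_def)
        finally show False using v s1 by (auto simp: S_def)
      qed
    qed
    then have "finite S" by (rule finite_subset) simp
    then obtain m0 where m0: "m0 \<in> S" "\<And>v. v \<in> S \<Longrightarrow> \<psi> m0 \<le> \<psi> v"
      using ne ex_min_if_finite[of "\<psi> ` S"] by (auto simp: not_less)
    have lowest: "\<psi> m0 \<le> \<psi> v" for v
      using m0 by (cases "v \<in> S") (auto simp: S_def)
    have "K < m0"
    proof (rule ccontr)
      assume "\<not> K < m0"
      then have "s \<le> h m0" by (simp add: s_le)
      also have "\<dots> \<le> \<psi> m0" by (simp add: \<psi>_def)
      finally show False using m0 by (auto simp: S_def)
    qed
    then have "T \<psi> m0 \<le> \<psi> m0"
      using K[of m0] unfolding \<psi>_def[abs_def] T_add T_cmult h_harmonic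
      by (intro add_left_mono mult_left_mono) auto
    moreover have "\<psi> m0 < 1"
      using less_le_trans[OF _ s1] m0(1) by (simp add: S_def)
    then have "\<psi> m0 < \<top>" by (rule less_trans) simp
    ultimately have "\<psi> 0 \<le> \<psi> m0" by (intro minimum_at_0[of "\<psi> m0" \<psi> m0] lowest)
    moreover have "\<psi> 0 = 1" by (simp add: \<psi>_def lyap_0 h_0)
    ultimately show False using m0 s1 by (auto simp: S_def)
  qed
  have above: "s \<le> h v" for v
  proof (rule tendsto_lowerbound)
    have "((\<lambda>\<epsilon>. h v + ennreal \<epsilon> * lyap v) \<longlongrightarrow> h v + ennreal 0 * lyap v) (at_right 0)"
      using lyap_finite[of v]
      by (intro tendsto_add tendsto_const tendsto_mult_ennreal
          tendsto_ennrealI tendsto_ident_at) auto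
    then show "((\<lambda>\<epsilon>. h v + ennreal \<epsilon> * lyap v) \<longlongrightarrow> h v) (at_right (0::real))" by simp
    show "eventually (\<lambda>\<epsilon>. s \<le> h v + ennreal \<epsilon> * lyap v) (at_right (0::real))"
      using eventually_at_right_less[of "0::real"] by eventually_elim (rule below)
  qed simp
  \<comment> \<open>Now \<open>s = h m1\<close> is a global minimum of the harmonic function
    \<open>h\<close>, so the minimum principle applies once more.\<close>
  have "h 0 \<le> s"
    using above by (rule minimum_at_0[of s h m1]) (use le_less_trans[OF s1] m1 in \<open>auto simp: h_harmonic\<close>)
  then have "1 \<le> h n" using above[of n] by (auto simp: h_0)
  moreover have "h n \<le> 1"
  proof -
    have "ext k v \<le> 1" for k v
    proof (induction k arbitrary: v)
      case (Suc k)
      then have "T (ext k) v \<le> T (\<lambda>_. 1) v" by (intro T_mono) 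
      then show ?case by (simp add: ext_simps T_const)
    qed (simp add: ext_simps)
    then show ?thesis unfolding h_def by (intro SUP_least)
  qed
  ultimately show ?thesis by simp
qed

end

subsection \<open>Survival\<close>

context
  assumes delta: "1 < \<delta>"
begin

text \<open>The exponent lies strictly between 1 and \<delta>: above 1 the weights are summable,
  below \<delta> they decrease more slowly than the factor \<open>r\<close> demands.\<close>

lemma survival_weight:
  "\<exists>t0\<ge>1. \<forall>t\<ge>t0. real t powr - ((1 + \<delta>) / 2) * r t \<le> real (Suc t) powr - ((1 + \<delta>) / 2)"
proof -
  have "eventually (\<lambda>x::real. x powr - ((1 + \<delta>) / 2) * (1 - \<delta> / (x + 1) + C / (x + 1)\<^sup>2)
      \<le> (x + 1) powr - ((1 + \<delta>) / 2)) at_top"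
    using delta by real_asymp
  then have "eventually (\<lambda>t. real t powr - ((1 + \<delta>) / 2) * (1 - \<delta> / (real t + 1) + C / (real t + 1)\<^sup>2)
      \<le> (real t + 1) powr - ((1 + \<delta>) / 2)) sequentially"
    by (rule eventually_compose_filterlim[OF _ filterlim_real_sequentially])
  then obtain t0 where t0: "\<And>t. t \<ge> t0 \<Longrightarrow>
      real t powr - ((1 + \<delta>) / 2) * (1 - \<delta> / (real t + 1) + C / (real t + 1)\<^sup>2)
      \<le> (real t + 1) powr - ((1 + \<delta>) / 2)"
    by (auto simp: eventually_sequentially)
  have "real t powr - ((1 + \<delta>) / 2) * r t \<le> real (Suc t) powr - ((1 + \<delta>) / 2)"
    if "t \<ge> max t0 1" for t
  proof -
    have "r t \<le> 1 - \<delta> / (real t + 1) + C / (real t + 1)\<^sup>2"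
      using r_bound[of t] by linarith
    then have "real t powr - ((1 + \<delta>) / 2) * r t
        \<le> real t powr - ((1 + \<delta>) / 2) * (1 - \<delta> / (real t + 1) + C / (real t + 1)\<^sup>2)"
      by (intro mult_left_mono) auto
    also have "\<dots> \<le> (real t + 1) powr - ((1 + \<delta>) / 2)" using that by (intro t0) auto
    finally show ?thesis by (simp add: add_ac)
  qed
  then show ?thesis by (intro exI[of _ "max t0 1"]) auto
qed

text \<open>The mixture \<open>f\<close> decreases to 0 and is superharmonic from \<open>M\<close>
  on: \<open>T\<close> shifts the index, the next weight absorbs \<open>r\<close>, and one
  nonnegative term of \<open>f\<close> is left over.\<close>

lemma extinction_small:
  assumes "0 < e"
  shows "\<exists>n. \<forall>k. ext k n \<le> ennreal e"
proof -
  obtain t0 where t0: "t0 \<ge> 1"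
    "\<And>t. t \<ge> t0 \<Longrightarrow> real t powr - ((1 + \<delta>) / 2) * r t \<le> real (Suc t) powr - ((1 + \<delta>) / 2)"
    using survival_weight by blast
  define w where "w t = real (t + t0) powr - ((1 + \<delta>) / 2)" for t
  have w: "0 < w t" "w t * r (t + t0) \<le> w (Suc t)" for t
    using t0(1) t0(2)[of "t + t0"] by (auto simp: w_def)
  define f where "f v = (\<Sum>t. ennreal (w t * quot (t + t0) ^ v))" for v
  have "summable (\<lambda>t. real t powr - ((1 + \<delta>) / 2))"
    using delta by (subst summable_real_powr_iff) simp
  then have "summable w"
    unfolding w_def[abs_def] by (subst summable_iff_shift)
  then have fin: "(\<Sum>t. ennreal (w t)) < \<top>"
    using w(1) by (subst suminf_ennreal2) (auto simp: less_imp_le)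
  have anti: "f v' \<le> f v" if "v \<le> v'" for v v'
    unfolding f_def using that quot_bounds w(1)
    by (intro suminf_le ennreal_leI mult_left_mono power_decreasing) (auto simp: less_imp_le)
  have f_fin: "f v < \<top>" for v
    using anti[of 0 v] fin by (auto simp: f_def intro: le_less_trans)
  have f_pos: "0 < f v" for v
  proof -
    have "0 < ennreal (w 0 * quot (0 + t0) ^ v)"
      using w(1)[of 0] t0(1) by (auto simp: quot_def intro!: mult_pos_pos)
    also have "\<dots> = (\<Sum>t<1. ennreal (w t * quot (t + t0) ^ v))" by simp
    also have "\<dots> \<le> f v" unfolding f_def by (intro sum_le_suminf) auto
    finally show ?thesis .
  qed
  have "f \<longlonglongrightarrow> (\<integral>\<^sup>+t. 0 \<partial>count_space (UNIV :: nat set))"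
    unfolding f_def[abs_def] nn_integral_count_space_nat[symmetric]
  proof (rule nn_integral_dominated_convergence[where w = "\<lambda>t. ennreal (w t)"])
    show "(\<integral>\<^sup>+t. ennreal (w t) \<partial>count_space UNIV) < \<infinity>"
      using fin by (simp add: nn_integral_count_space_nat)
    show "AE t in count_space UNIV. ennreal (w t * quot (t + t0) ^ v) \<le> ennreal (w t)" for v
      using w(1) quot_power_le by (auto simp: less_imp_le mult_left_le intro!: AE_I2 ennreal_leI)
    have "(\<lambda>v. ennreal (w t * quot (t + t0) ^ v)) \<longlonglongrightarrow> ennreal (w t * 0)" for t
      using quot_bounds by (intro tendsto_ennrealI tendsto_intros LIMSEQ_power_zero) auto
    then show "AE t in count_space UNIV. (\<lambda>v. ennreal (w t * quot (t + t0) ^ v)) \<longlonglongrightarrow> 0"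
      by simp
  qed auto
  then have f_0: "f \<longlonglongrightarrow> 0" by simp
  have super: "T f m \<le> f m" if "M \<le> m" for m
  proof -
    have "T f m = (\<Sum>t. ennreal (w t) * T (\<lambda>v. ennreal (quot (t + t0) ^ v)) m)"
      unfolding f_def[abs_def] T_suminf T_cmult[symmetric]
      using w(1) quot_bounds by (simp add: ennreal_mult less_imp_le)
    also have "\<dots> = (\<Sum>t. ennreal (w t * r (t + t0) * quot (Suc t + t0) ^ m))"
      using w(1) r_nonneg quot_bounds by (simp add: T_quot[OF that] ennreal_mult less_imp_le mult.assoc)
    also have "\<dots> \<le> (\<Sum>t. ennreal (w (Suc t) * quot (Suc t + t0) ^ m))"
      using w quot_bounds by (intro suminf_le ennreal_leI mult_right_mono) auto
    also have "\<dots> \<le> f m"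
      unfolding f_def by (rule suminf_Suc_le_ennreal)
    finally show ?thesis .
  qed
  \<comment> \<open>Below \<open>M\<close> there is no formula for \<open>T\<close>. Capping at
    \<open>f M\<close> helps there: since \<open>f\<close> decreases, \<open>g\<close> equals its
    upper bound on that range.\<close>
  define g where "g v = min (f v) (f M)" for v
  have g_super: "T g m \<le> g m" for m
  proof -
    have "T g m \<le> T (\<lambda>_. f M) m" by (intro T_mono) (simp add: g_def)
    then have 1: "T g m \<le> f M" by (simp add: T_const)
    have "T g m \<le> f m"
    proof (cases "M \<le> m")
      case True
      have "T g m \<le> T f m" by (intro T_mono) (simp add: g_def)
      with super[OF True] show ?thesis by simp
    next
      case False
      with 1 anti[of m M] show ?thesis by simp
    qed
    with 1 show ?thesis by (simp add: g_def)
  qed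
  have ext_le: "f M * ext k v \<le> g v" for k v
  proof (induction k arbitrary: v)
    case 0
    show ?case using anti[of 0 M] by (simp add: ext_simps g_def)
  next
    case (Suc k)
    have "f M * ext (Suc k) v = T (\<lambda>v. f M * ext k v) v"
      by (simp add: ext_simps T_cmult)
    also have "\<dots> \<le> T g v" by (intro T_mono Suc)
    finally show ?case using g_super[of v] by simp
  qed
  have "0 < f M * ennreal e"
    using f_pos assms by (simp add: ennreal_zero_less_mult_iff)
  then have "eventually (\<lambda>n. f n < f M * ennreal e) sequentially"
    using f_0 by (intro order_tendstoD)
  then obtain n where n: "f n < f M * ennreal e"
    by (auto simp: eventually_sequentially)
  have "ext k n \<le> ennreal e" for k
  proof -
    have "f M * ext k n \<le> f n"
      using ext_le[of k n] by (simp add: g_def)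
    with n have "f M * ext k n \<le> f M * ennreal e" by order
    then show ?thesis
      using f_pos[of M] f_fin[of M] by (subst (asm) ennreal_mult_le_mult_iff) auto
  qed
  then show ?thesis by blast
qed

end

end

section \<open>The annealed measure\<close>

text \<open>A new factor at most doubles the old error and adds a cross term of size at most
  \<open>n * x\<^sup>2\<close>, which the constant \<open>4 ^ n\<close> accommodates.\<close>

lemma prod_first_order:
  fixes d :: "nat \<Rightarrow> real"
  assumes "\<And>i. \<bar>d i\<bar> \<le> 1" "0 \<le> x" "x \<le> 1"
  shows "\<bar>(\<Prod>i=1..n. 1 - d i * x) - (1 - x * (\<Sum>i=1..n. d i))\<bar> \<le> 4 ^ n * x\<^sup>2"
proof (induction n)
  case (Suc n)
  define e where "e = (\<Prod>i=1..n. 1 - d i * x) - (1 - x * (\<Sum>i=1..n. d i))"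
  let ?d = "d (Suc n)" and ?S = "\<Sum>i=1..n. d i"
  have d: "\<bar>?d\<bar> \<le> 1" by (rule assms)
  have S: "\<bar>?S\<bar> \<le> real n"
    by (rule order_trans[OF sum_abs]) (use sum_bounded_above[of "{1..n}" "\<lambda>i. \<bar>d i\<bar>" 1] assms(1) in simp)
  have "(\<Prod>i=1..Suc n. 1 - d i * x) - (1 - x * (\<Sum>i=1..Suc n. d i)) = x\<^sup>2 * (?d * ?S) + e * (1 - ?d * x)"
    by (simp add: e_def algebra_simps power2_eq_square)
  also have "\<bar>\<dots>\<bar> \<le> \<bar>x\<^sup>2 * (?d * ?S)\<bar> + \<bar>e * (1 - ?d * x)\<bar>" by (rule abs_triangle_ineq)
  also have "\<bar>x\<^sup>2 * (?d * ?S)\<bar> \<le> x\<^sup>2 * (1 * real n)"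
    unfolding abs_mult using d S by (intro mult_mono) auto
  also have "\<bar>e * (1 - ?d * x)\<bar> \<le> (4 ^ n * x\<^sup>2) * 2"
  proof -
    have "\<bar>?d * x\<bar> \<le> 1 * 1" unfolding abs_mult using d assms by (intro mult_mono) auto
    then have "\<bar>1 - ?d * x\<bar> \<le> 2" by linarith
    then show ?thesis
      unfolding abs_mult[of e] using Suc by (intro mult_mono) (auto simp: e_def)
  qed
  also have "x\<^sup>2 * (1 * real n) + (4 ^ n * x\<^sup>2) * 2 = (real n + 2 * 4 ^ n) * x\<^sup>2"
    by (simp add: algebra_simps)
  also have "\<dots> \<le> 4 ^ Suc n * x\<^sup>2"
  proof (rule mult_right_mono)
    have "real n \<le> 4 ^ n"
      using Bernoulli_inequality[of 3 n] by simp
    moreover have "0 \<le> (4::real) ^ n" by simp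
    ultimately show "real n + 2 * 4 ^ n \<le> 4 ^ Suc n" unfolding power_Suc by linarith
  qed simp
  finally show ?case by simp
qed simp

lemma space_cookie_space: "space cookie_space = extensional {1..}"
  by (simp add: cookie_space_def space_PiM PiE_def)

section \<open>The law of one site and its offspring distribution\<close>

locale cookie_law = prob_space P for P :: "(int \<Rightarrow> nat \<Rightarrow> real) measure" +
  fixes M :: nat
  assumes sets_P: "sets P = sets (env_space M)"
    and iid: "iid_env P"
    and elliptic: "elliptic_env M P"
begin

lemma space_P: "space P = cookie_envs M"
proof -
  have "space P = space (env_space M)" by (rule sets_eq_imp_space_eq[OF sets_P])
  then show ?thesis
    by (auto simp: env_space_def space_restrict_space space_PiM space_cookie_space cookie_envs_def)
qed

lemma cookie_bounds:
  assumes "\<omega> \<in> space P"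
  shows "i \<ge> 1 \<Longrightarrow> \<omega> z i \<in> {0..1}" "i > M \<Longrightarrow> \<omega> z i = 1 / 2"
proof -
  have \<omega>: "\<forall>z. (\<forall>i\<in>{1..M}. \<omega> z i \<in> {0..1}) \<and> (\<forall>i>M. \<omega> z i = 1 / 2)"
    using assms unfolding space_P cookie_envs_def by blast
  then show "i > M \<Longrightarrow> \<omega> z i = 1 / 2" by blast
  show "\<omega> z i \<in> {0..1}" if "i \<ge> 1"
  proof (cases "i \<le> M")
    case False
    then have "\<omega> z i = 1 / 2" using \<omega> by simp
    then show ?thesis by simp
  qed (use \<omega> that in simp)
qed

lemma indep_cookies: "indep_vars (\<lambda>z. cookie_space) (\<lambda>z \<omega>. \<omega> z) UNIV"
  using iid by (simp add: iid_env_def)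

lemma measurable_site [measurable]: "(\<lambda>\<omega>. \<omega> z) \<in> measurable P cookie_space"
  using indep_cookies by (auto simp: indep_vars_def)

lemma measurable_cookie [measurable]: "(\<lambda>\<theta>. \<theta> (Suc i)) \<in> borel_measurable cookie_space"
  unfolding cookie_space_def by (rule measurable_component_singleton) simp

lemma measurable_cookie' [measurable]: "(\<lambda>\<omega>. \<omega> z (Suc i)) \<in> borel_measurable P"
  by (rule measurable_compose[OF measurable_site measurable_cookie])

lemma measurable_cookie1: "1 \<le> i \<Longrightarrow> (\<lambda>\<omega>. \<omega> z i) \<in> borel_measurable P"
  by (cases i) auto

definition law :: "(nat \<Rightarrow> real) measure" where
  "law = distr P cookie_space (\<lambda>\<omega>. \<omega> 0)"

lemma law_eq: "distr P cookie_space (\<lambda>\<omega>. \<omega> z) = law"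
  using iid by (simp add: iid_env_def law_def)

lemma sets_law [measurable_cong]: "sets law = sets cookie_space"
  by (simp add: law_def)

lemma prob_space_law: "prob_space law"
  unfolding law_def by (rule prob_space_distr) measurable

text \<open>The cookie stack is kept as a single variable because cookies at the same site may be
  dependent.\<close>

definition site :: "((nat \<Rightarrow> real) \<times> (nat \<Rightarrow> real)) measure" where
  "site = law \<Otimes>\<^sub>M rows"

lemma sets_site [measurable_cong]: "sets site = sets (cookie_space \<Otimes>\<^sub>M rows)"
  unfolding site_def by (intro sets_pair_measure_cong sets_law refl)

lemma prob_space_site: "prob_space site"
proof -
  interpret L: prob_space law by (rule prob_space_law)
  interpret R: prob_space rows by (rule prob_space_rows)
  interpret pair_prob_space law rows ..
  show ?thesis unfolding site_def by (rule prob_space_axioms)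
qed

definition offspring :: "bool \<Rightarrow> nat \<Rightarrow> (nat \<Rightarrow> real) \<times> (nat \<Rightarrow> real) \<Rightarrow> nat" where
  "offspring s m w = progeny m (coins s (fst w) (snd w))"

lemma pred_coins_site [measurable]:
  "Measurable.pred (cookie_space \<Otimes>\<^sub>M rows) (\<lambda>w. coins s (fst w) (snd w) i)"
  unfolding coins_def by measurable

lemma offspring_measurable [measurable]:
  "offspring s m \<in> measurable (cookie_space \<Otimes>\<^sub>M rows) (count_space UNIV)"
  unfolding offspring_def[abs_def] by measurable

definition fac :: "bool \<Rightarrow> real \<Rightarrow> (nat \<Rightarrow> real) \<Rightarrow> real" where
  "fac s x \<theta> = (\<Prod>i=1..M. 1 - (2 * pr s (\<theta> i) - 1) * x)"

definition rho :: "bool \<Rightarrow> real \<Rightarrow> real" where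
  "rho s x = (\<integral>\<omega>. fac s x (\<omega> 0) \<partial>P)"

definition drift :: "bool \<Rightarrow> real" where
  "drift s = (if s then total_drift M P else - total_drift M P)"

lemma measurable_pr: "(\<lambda>\<omega>. 2 * pr s (\<omega> z (Suc i)) - 1) \<in> borel_measurable P"
  unfolding pr_def by (cases s) simp_all

lemma measurable_fac [measurable]: "(\<lambda>\<omega>. fac s x (\<omega> z)) \<in> borel_measurable P"
proof -
  have "(\<lambda>\<omega>. \<Prod>i<M. 1 - (2 * pr s (\<omega> z (Suc i)) - 1) * x) \<in> borel_measurable P"
    using measurable_pr by measurable
  then show ?thesis
    unfolding fac_def by (simp add: prod.atLeast1_atMost_eq)
qed

lemma fac_bounds:
  assumes "\<omega> \<in> space P" "0 \<le> x" "x \<le> 1"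
  shows "0 \<le> fac s x (\<omega> z)" "\<bar>fac s x (\<omega> z)\<bar> \<le> 2 ^ M"
proof -
  have *: "0 \<le> 1 - (2 * pr s (\<omega> z i) - 1) * x \<and> 1 - (2 * pr s (\<omega> z i) - 1) * x \<le> 2" if "i \<ge> 1" for i
  proof -
    have "pr s (\<omega> z i) \<in> {0..1}"
      using cookie_bounds(1)[OF assms(1) that] by (rule pr_bounds)
    then have "\<bar>2 * pr s (\<omega> z i) - 1\<bar> \<le> 1" by auto
    then have "\<bar>(2 * pr s (\<omega> z i) - 1) * x\<bar> \<le> 1 * 1"
      unfolding abs_mult using assms by (intro mult_mono) auto
    then show ?thesis by linarith
  qed
  show "0 \<le> fac s x (\<omega> z)"
    unfolding fac_def using * by (intro prod_nonneg) auto
  moreover have "fac s x (\<omega> z) \<le> (\<Prod>i=1..M. 2)"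
    unfolding fac_def using * by (intro prod_mono) auto
  ultimately show "\<bar>fac s x (\<omega> z)\<bar> \<le> 2 ^ M" by simp
qed

lemma integrable_fac: "0 \<le> x \<Longrightarrow> x \<le> 1 \<Longrightarrow> integrable P (\<lambda>\<omega>. fac s x (\<omega> 0))"
  by (rule integrable_const_bound[where B = "2 ^ M"]) (auto intro!: AE_I2 fac_bounds)

lemma drift_eq:
  "drift s = (\<integral>\<omega>. (\<Sum>i=1..M. 2 * pr s (\<omega> 0 i) - 1) \<partial>P)"
  and integrable_drift: "integrable P (\<lambda>\<omega>. \<Sum>i=1..M. 2 * pr s (\<omega> 0 i) - 1)"
proof -
  have *: "integrable P (\<lambda>\<omega>. \<Sum>i=1..M. 2 * pr s (\<omega> 0 i) - 1)" for s
  proof (rule Bochner_Integration.integrable_sum)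
    fix i assume i: "i \<in> {1..M}"
    then have [measurable]: "(\<lambda>\<omega>. \<omega> 0 i) \<in> borel_measurable P"
      by (intro measurable_cookie1) simp
    show "integrable P (\<lambda>\<omega>. 2 * pr s (\<omega> 0 i) - 1)"
    proof (rule integrable_const_bound[where B = 1])
      show "AE \<omega> in P. norm (2 * pr s (\<omega> 0 i) - 1) \<le> 1"
        using cookie_bounds(1) i by (intro AE_I2) (force simp: pr_def abs_le_iff)
    qed (cases s, auto simp: pr_def)
  qed
  show "integrable P (\<lambda>\<omega>. \<Sum>i=1..M. 2 * pr s (\<omega> 0 i) - 1)" by (rule *)
  have neg: "(\<Sum>i=1..M. 2 * pr False (\<omega> 0 i) - 1) = - (\<Sum>i=1..M. 2 * pr True (\<omega> 0 i) - 1)" for \<omega> :: "int \<Rightarrow> nat \<Rightarrow> real"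
    by (simp add: pr_def flip: sum_negf)
  show "drift s = (\<integral>\<omega>. (\<Sum>i=1..M. 2 * pr s (\<omega> 0 i) - 1) \<partial>P)"
  proof (cases s)
    case True
    then show ?thesis by (simp add: drift_def total_drift_def pr_def)
  next
    case False
    have "(\<integral>\<omega>. (\<Sum>i=1..M. 2 * pr False (\<omega> 0 i) - 1) \<partial>P) = - (\<integral>\<omega>. (\<Sum>i=1..M. 2 * pr True (\<omega> 0 i) - 1) \<partial>P)"
      unfolding neg by simp
    then show ?thesis using False by (simp add: drift_def total_drift_def pr_def)
  qed
qed

lemma rho_bound:
  assumes x: "0 \<le> x" "x \<le> 1"
  shows "\<bar>rho s x - (1 - drift s * x)\<bar> \<le> 4 ^ M * x\<^sup>2"
proof -
  let ?S = "\<lambda>\<omega>. \<Sum>i=1..M. 2 * pr s (\<omega> 0 i) - 1"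
  have "rho s x - (1 - drift s * x) = (\<integral>\<omega>. fac s x (\<omega> 0) - (1 - x * ?S \<omega>) \<partial>P)"
    unfolding rho_def drift_eq using integrable_drift[of s] integrable_fac[OF x, of s]
    by (simp add: prob_space)
  also have "\<bar>\<dots>\<bar> \<le> (\<integral>\<omega>. \<bar>fac s x (\<omega> 0) - (1 - x * ?S \<omega>)\<bar> \<partial>P)"
    by (rule integral_abs_bound)
  also have "\<dots> \<le> (\<integral>\<omega>. 4 ^ M * x\<^sup>2 \<partial>P)"
  proof (rule integral_mono)
    fix \<omega> assume \<omega>: "\<omega> \<in> space P"
    \<comment> \<open>\<open>prod_first_order\<close> asks for a bound at every index, but index 0
      holds only a dummy cookie; it is replaced by 0.\<close>
    have "\<bar>if 1 \<le> i then 2 * pr s (\<omega> 0 i) - 1 else 0\<bar> \<le> 1" for i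
      using pr_bounds[OF cookie_bounds(1)[OF \<omega>, of i 0], of s] by (auto simp: abs_le_iff)
    from prod_first_order[of "\<lambda>i. if 1 \<le> i then 2 * pr s (\<omega> 0 i) - 1 else 0", OF this x, of M]
    show "\<bar>fac s x (\<omega> 0) - (1 - x * ?S \<omega>)\<bar> \<le> 4 ^ M * x\<^sup>2"
      unfolding fac_def by (simp cong: prod.cong_simp sum.cong_simp)
  qed (use integrable_drift[of s] integrable_fac[OF x, of s] in auto)
  finally show ?thesis by (simp add: prob_space)
qed

lemma nn_integral_site:
  assumes [measurable]: "f \<in> borel_measurable (cookie_space \<Otimes>\<^sub>M rows)"
  shows "(\<integral>\<^sup>+w. f w \<partial>site) = (\<integral>\<^sup>+\<omega>. \<integral>\<^sup>+u. f (\<omega> 0, u) \<partial>rows \<partial>P)"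
proof -
  interpret R: prob_space rows by (rule prob_space_rows)
  have "(\<integral>\<^sup>+w. f w \<partial>site) = (\<integral>\<^sup>+\<theta>. \<integral>\<^sup>+u. f (\<theta>, u) \<partial>rows \<partial>law)"
    unfolding site_def by (intro R.nn_integral_fst[symmetric]) measurable
  also have "\<dots> = (\<integral>\<^sup>+\<omega>. \<integral>\<^sup>+u. f (\<omega> 0, u) \<partial>rows \<partial>P)"
    unfolding law_def by (intro nn_integral_distr) measurable
  finally show ?thesis .
qed

lemma offspring_gf:
  assumes "M \<le> m" "0 \<le> a" "a \<le> 1"
  shows "(\<integral>\<^sup>+w. ennreal (a ^ offspring s m w) \<partial>site) = ennreal (rho s (1 - a) / (2 - a) ^ m)"
proof -
  have "(\<integral>\<^sup>+w. ennreal (a ^ offspring s m w) \<partial>site) =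
      (\<integral>\<^sup>+\<omega>. \<integral>\<^sup>+u. ennreal (a ^ offspring s m (\<omega> 0, u)) \<partial>rows \<partial>P)"
    by (intro nn_integral_site measurable_compose[OF offspring_measurable]) simp
  also have "\<dots> = (\<integral>\<^sup>+\<omega>. ennreal (fac s (1 - a) (\<omega> 0) / (2 - a) ^ m) \<partial>P)"
  proof (rule nn_integral_cong)
    fix \<omega> assume "\<omega> \<in> space P"
    from progeny_gf[where \<theta> = "\<omega> 0" and M = M and m = m, OF assms(2,3) cookie_bounds[OF this] assms(1), of s]
    show "(\<integral>\<^sup>+u. ennreal (a ^ offspring s m (\<omega> 0, u)) \<partial>rows) = ennreal (fac s (1 - a) (\<omega> 0) / (2 - a) ^ m)"
      by (simp add: offspring_def fac_def)
  qed
  also have "\<dots> = ennreal (\<integral>\<omega>. fac s (1 - a) (\<omega> 0) / (2 - a) ^ m \<partial>P)"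
    using assms by (intro nn_integral_eq_integral integrable_divide_zero AE_I2 divide_nonneg_nonneg
        fac_bounds(1)) (auto intro: integrable_fac)
  finally show ?thesis by (simp add: rho_def)
qed

lemma AE_site_reaches: "AE w in site. reaches m (coins s (fst w) (snd w))"
proof -
  interpret S: prob_space site by (rule prob_space_site)
  interpret R: prob_space rows by (rule prob_space_rows)
  let ?A = "{w \<in> space site. reaches m (coins s (fst w) (snd w))}"
  have A: "?A \<in> sets site" by measurable
  have "emeasure site ?A = (\<integral>\<^sup>+w. indicator ?A w \<partial>site)" using A by simp
  also have "\<dots> = (\<integral>\<^sup>+\<omega>. \<integral>\<^sup>+u. indicator ?A (\<omega> 0, u) \<partial>rows \<partial>P)"
    using A by (intro nn_integral_site borel_measurable_indicator) (simp add: sets_site)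
  also have "\<dots> = (\<integral>\<^sup>+\<omega>. 1 \<partial>P)"
  proof (rule nn_integral_cong)
    fix \<omega> assume \<omega>: "\<omega> \<in> space P"
    have "AE u in rows. reaches m (coins s (\<omega> 0) u)"
      by (rule AE_reaches) (rule cookie_bounds[OF \<omega>]; assumption)+
    then have "(\<integral>\<^sup>+u. indicator ?A (\<omega> 0, u) \<partial>rows) = (\<integral>\<^sup>+u. 1 \<partial>rows)"
      using measurable_space[OF measurable_site \<omega>, of 0]
      by (intro nn_integral_cong_AE)
         (auto simp: indicator_def sets_eq_imp_space_eq[OF sets_site] space_pair_measure)
    then show "(\<integral>\<^sup>+u. indicator ?A (\<omega> 0, u) \<partial>rows) = 1" by (simp add: R.emeasure_space_1)
  qed
  finally have "S.prob ?A = 1" by (simp add: S.emeasure_eq_measure emeasure_space_1)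
  then show ?thesis using A by (subst (asm) S.prob_Collect_eq_1) auto
qed

text \<open>At \<open>x = 1\<close> each factor is twice a failure probability, so
  \<open>rho s 1\<close> is \<open>2 ^ M\<close> times one of the two expectations in the
  ellipticity assumption.\<close>

lemma rho_1_pos: "0 < rho s 1"
proof -
  have "rho s 1 = (\<integral>\<omega>. 2 ^ M * (\<Prod>i=1..M. 1 - pr s (\<omega> 0 i)) \<partial>P)"
    unfolding rho_def fac_def
  proof (intro Bochner_Integration.integral_cong refl)
    fix \<omega> :: "int \<Rightarrow> nat \<Rightarrow> real"
    have "(\<Prod>i=1..M. 1 - (2 * pr s (\<omega> 0 i) - 1) * 1) = (\<Prod>i=1..M. 2 * (1 - pr s (\<omega> 0 i)))"
      by (intro prod.cong) auto
    also have "\<dots> = 2 ^ M * (\<Prod>i=1..M. 1 - pr s (\<omega> 0 i))"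
      by (simp only: prod.distrib prod_constant card_atLeastAtMost diff_Suc_1)
    finally show "(\<Prod>i=1..M. 1 - (2 * pr s (\<omega> 0 i) - 1) * 1) = 2 ^ M * (\<Prod>i=1..M. 1 - pr s (\<omega> 0 i))" .
  qed
  also have "\<dots> = 2 ^ M * (\<integral>\<omega>. (\<Prod>i=1..M. 1 - pr s (\<omega> 0 i)) \<partial>P)" by simp
  also have "\<dots> > 0"
    using elliptic by (cases s) (simp_all add: elliptic_env_def pr_def)
  finally show ?thesis .
qed

text \<open>At \<open>a = 0\<close> the generating function is the probability of no offspring, as
  \<open>0 ^ 0 = 1\<close>. Fewer than \<open>M\<close> parents are handled by monotonicity in the
  number of parents.\<close>

lemma die: "0 < emeasure site {w \<in> space site. offspring s m w = 0}"
proof -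
  let ?n = "max m M"
  have "0 < ennreal (rho s 1 / 2 ^ ?n)" using rho_1_pos[of s] by simp
  also have "\<dots> = (\<integral>\<^sup>+w. ennreal (0 ^ offspring s ?n w) \<partial>site)"
    using offspring_gf[of ?n 0 s] by simp
  also have "\<dots> = (\<integral>\<^sup>+w. indicator {w \<in> space site. offspring s ?n w = 0} w \<partial>site)"
    by (intro nn_integral_cong) (auto simp: indicator_def power_0_left)
  also have "\<dots> = emeasure site {w \<in> space site. offspring s ?n w = 0}"
    by (intro nn_integral_indicator) measurable
  also have "\<dots> \<le> emeasure site {w \<in> space site. offspring s m w = 0}"
  proof (rule emeasure_mono_AE)
    show "AE w in site. w \<in> {w \<in> space site. offspring s ?n w = 0} \<longrightarrow>
        w \<in> {w \<in> space site. offspring s m w = 0}"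
      using AE_site_reaches[of ?n s]
    proof eventually_elim
      case (elim w)
      then have "offspring s m w \<le> offspring s ?n w"
        unfolding offspring_def by (intro progeny_mono) auto
      then show ?case by auto
    qed
  qed measurable
  finally show ?thesis .
qed

lemma branching_site: "branching site (offspring s) M (rho s) (drift s) (4 ^ M)"
proof -
  interpret S: prob_space site by (rule prob_space_site)
  show ?thesis
  proof
    show "offspring s m \<in> measurable site (count_space UNIV)" for m by measurable
    show "offspring s 0 w = 0" for w by (simp add: offspring_def)
    show "(\<integral>\<^sup>+w. ennreal (a ^ offspring s m w) \<partial>site) = ennreal (rho s (1 - a) / (2 - a) ^ m)"
      if "M \<le> m" "0 \<le> a" "a \<le> 1" for m a using that by (rule offspring_gf)
    show "\<bar>rho s x - (1 - drift s * x)\<bar> \<le> 4 ^ M * x\<^sup>2" if "0 \<le> x" "x \<le> 1" for x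
      using that by (rule rho_bound)
    show "0 \<le> rho s x" if "0 \<le> x" "x \<le> 1" for x
      unfolding rho_def using that by (intro integral_nonneg_AE AE_I2 fac_bounds(1))
    show "0 < emeasure site {w \<in> space site. offspring s m w = 0}" for m by (rule die)
  qed
qed

end

section \<open>Independence across sites\<close>

lemma indep_vars_pair:
  assumes "prob_space A" "prob_space B"
    and X: "prob_space.indep_vars A S X I" and Y: "prob_space.indep_vars B T Y I"
  shows "prob_space.indep_vars (A \<Otimes>\<^sub>M B) (\<lambda>i. S i \<Otimes>\<^sub>M T i) (\<lambda>i x. (X i (fst x), Y i (snd x))) I"
proof -
  interpret A: prob_space A by fact
  interpret B: prob_space B by fact
  interpret pair_prob_space A B ..
  have rv: "X i \<in> measurable A (S i)" "Y i \<in> measurable B (T i)" if "i \<in> I" for i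
    using X Y that by (auto simp: A.indep_vars_def B.indep_vars_def)
  \<comment> \<open>Rectangles are stable under intersection and generate the events of the pair; on
    them the product measure factorises.\<close>
  define G where "G i = {(X i -` E \<inter> space A) \<times> (Y i -` F \<inter> space B) | E F. E \<in> sets (S i) \<and> F \<in> sets (T i)}" for i
  have "indep_sets G I"
  proof (rule indep_setsI)
    show "G i \<subseteq> events" if "i \<in> I" for i
      unfolding G_def using rv[OF that] by (auto intro!: pair_measureI measurable_sets)
    fix H J assume J: "J \<noteq> {}" "J \<subseteq> I" "finite J" and "\<forall>j\<in>J. H j \<in> G j"
    then have "\<forall>j\<in>J. \<exists>E F. E \<in> sets (S j) \<and> F \<in> sets (T j) \<and>
        H j = (X j -` E \<inter> space A) \<times> (Y j -` F \<inter> space B)"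
      unfolding G_def by blast
    then obtain E F where EF: "\<And>j. j \<in> J \<Longrightarrow> E j \<in> sets (S j)" "\<And>j. j \<in> J \<Longrightarrow> F j \<in> sets (T j)"
      and H: "\<And>j. j \<in> J \<Longrightarrow> H j = (X j -` E j \<inter> space A) \<times> (Y j -` F j \<inter> space B)"
      by metis
    have times: "prob (a \<times> b) = A.prob a * B.prob b" if "a \<in> A.events" "b \<in> B.events" for a b
      using that by (simp add: measure_def B.emeasure_pair_measure_Times enn2real_mult)
    let ?E = "\<lambda>j. X j -` E j \<inter> space A" and ?F = "\<lambda>j. Y j -` F j \<inter> space B"
    have ev: "?E j \<in> A.events" "?F j \<in> B.events" if "j \<in> J" for j
      using that J EF rv by (auto intro!: measurable_sets)
    have "(\<Inter>j\<in>J. H j) = (\<Inter>j\<in>J. ?E j) \<times> (\<Inter>j\<in>J. ?F j)"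
      using J(1) H by auto
    moreover have "(\<Inter>j\<in>J. ?E j) \<in> A.events" "(\<Inter>j\<in>J. ?F j) \<in> B.events"
      by (rule sets.finite_INT[OF J(3,1)], erule ev)+
    ultimately have "prob (\<Inter>j\<in>J. H j) = A.prob (\<Inter>j\<in>J. ?E j) * B.prob (\<Inter>j\<in>J. ?F j)"
      by (simp only: times)
    also have "A.prob (\<Inter>j\<in>J. ?E j) = (\<Prod>j\<in>J. A.prob (?E j))"
      using X J EF by (intro A.indep_varsD) auto
    also have "B.prob (\<Inter>j\<in>J. ?F j) = (\<Prod>j\<in>J. B.prob (?F j))"
      using Y J EF by (intro B.indep_varsD) auto
    also have "(\<Prod>j\<in>J. A.prob (?E j)) * (\<Prod>j\<in>J. B.prob (?F j)) = (\<Prod>j\<in>J. prob (H j))"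
      using ev by (simp add: H times prod.distrib)
    finally show "prob (\<Inter>j\<in>J. H j) = (\<Prod>j\<in>J. prob (H j))" .
  qed
  moreover have "Int_stable (G i)" for i
  proof (rule Int_stableI)
    fix a b assume "a \<in> G i" "b \<in> G i"
    then obtain E F E' F' where EF: "E \<in> sets (S i)" "F \<in> sets (T i)" "E' \<in> sets (S i)" "F' \<in> sets (T i)"
      and ab: "a = (X i -` E \<inter> space A) \<times> (Y i -` F \<inter> space B)"
        "b = (X i -` E' \<inter> space A) \<times> (Y i -` F' \<inter> space B)"
      unfolding G_def by blast
    have "a \<inter> b = (X i -` (E \<inter> E') \<inter> space A) \<times> (Y i -` (F \<inter> F') \<inter> space B)"
      unfolding ab by auto
    then show "a \<inter> b \<in> G i"
      unfolding G_def using EF by blast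
  qed
  ultimately have sigma: "indep_sets (\<lambda>i. sigma_sets (space (A \<Otimes>\<^sub>M B)) (G i)) I"
    by (intro indep_sets_sigma)
  show ?thesis
    unfolding indep_vars_def2
  proof safe
    fix i assume "i \<in> I"
    from rv[OF this] show "(\<lambda>x. (X i (fst x), Y i (snd x))) \<in> measurable (A \<Otimes>\<^sub>M B) (S i \<Otimes>\<^sub>M T i)"
      by (intro measurable_Pair) (auto intro: measurable_compose[OF measurable_fst] measurable_compose[OF measurable_snd])
  next
    show "indep_sets (\<lambda>i. {(\<lambda>x. (X i (fst x), Y i (snd x))) -` C \<inter> space (A \<Otimes>\<^sub>M B) | C. C \<in> sets (S i \<Otimes>\<^sub>M T i)}) I"
    proof (rule indep_sets_mono_sets[OF sigma])
      fix i assume i: "i \<in> I"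
      let ?W = "\<lambda>x. (X i (fst x), Y i (snd x))"
      have G: "G i \<subseteq> Pow (space (A \<Otimes>\<^sub>M B))"
        unfolding G_def by (auto simp: space_pair_measure)
      have "?W \<in> measurable (sigma (space (A \<Otimes>\<^sub>M B)) (G i)) (S i \<Otimes>\<^sub>M T i)"
      proof (rule measurable_pair_measureI)
        show "?W \<in> space (sigma (space (A \<Otimes>\<^sub>M B)) (G i)) \<rightarrow> space (S i) \<times> space (T i)"
          using rv[OF i, THEN measurable_space] G by (auto simp: space_pair_measure space_measure_of)
        fix E F assume EF: "E \<in> sets (S i)" "F \<in> sets (T i)"
        have "?W -` (E \<times> F) \<inter> space (sigma (space (A \<Otimes>\<^sub>M B)) (G i)) = (X i -` E \<inter> space A) \<times> (Y i -` F \<inter> space B)"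
          using G by (auto simp: space_pair_measure space_measure_of)
        also have "\<dots> \<in> sets (sigma (space (A \<Otimes>\<^sub>M B)) (G i))"
          using G EF unfolding sets_measure_of[OF G] by (intro sigma_sets.Basic) (auto simp: G_def)
        finally show "?W -` (E \<times> F) \<inter> space (sigma (space (A \<Otimes>\<^sub>M B)) (G i)) \<in> sets (sigma (space (A \<Otimes>\<^sub>M B)) (G i))" .
      qed
      from measurable_sets[OF this]
      show "{?W -` C \<inter> space (A \<Otimes>\<^sub>M B) | C. C \<in> sets (S i \<Otimes>\<^sub>M T i)} \<subseteq> sigma_sets (space (A \<Otimes>\<^sub>M B)) (G i)"
        using G by (auto simp: sets_measure_of space_measure_of)
    qed
  qed
qed

lemma nn_integral_distr_borel:
  assumes "T \<in> measurable M N" "f \<in> borel_measurable N"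
  shows "(\<integral>\<^sup>+y. f y \<partial>distr M N T) = (\<integral>\<^sup>+x. f (T x) \<partial>M)"
  using assms by (simp add: nn_integral_distr)

abbreviation noise :: "(int \<times> nat \<Rightarrow> real) measure" where
  "noise \<equiv> (\<Pi>\<^sub>M p\<in>(UNIV :: (int \<times> nat) set). unif)"

lemma prob_space_noise: "prob_space noise"
  by (intro prob_space_PiM prob_space_unif)

lemma measurable_noise_row [measurable]: "(\<lambda>U i. U (z, i)) \<in> measurable noise rows"
  by (intro measurable_abs_UNIV) measurable

lemma distr_noise_row: "distr noise rows (\<lambda>U i. U (z, i)) = rows"
  using distr_PiM_reindex[of UNIV "\<lambda>_. unif" "\<lambda>i. (z, i)" UNIV] prob_space_unif
  by (simp add: inj_on_def restrict_UNIV)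

text \<open>Independent coordinates are grouped into the disjoint blocks
  \<open>{z} \<times> UNIV\<close>, and each block is reindexed as a row.\<close>

lemma indep_noise_rows: "prob_space.indep_vars noise (\<lambda>z. rows) (\<lambda>z U i. U (z, i)) (UNIV :: int set)"
proof -
  interpret U: prob_space unif by (rule prob_space_unif)
  interpret product_prob_space "\<lambda>_. unif" "UNIV :: (int \<times> nat) set" ..
  have "distr noise unif (\<lambda>U. U p) = unif" for p
    by (rule PiM_component) simp
  then have "indep_vars (\<lambda>_. unif) (\<lambda>p U. U p) (UNIV :: (int \<times> nat) set)"
    by (subst indep_vars_iff_distr_eq_PiM) (auto simp: distr_id restrict_UNIV)
  then have "indep_vars (\<lambda>z. PiM ({z} \<times> UNIV) (\<lambda>_. unif))
      (\<lambda>z U. restrict (\<lambda>p. U p) ({z} \<times> UNIV)) (UNIV :: int set)"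
    by (rule indep_vars_restrict) (auto simp: disjoint_family_on_def)
  then have "indep_vars (\<lambda>z. rows) (\<lambda>z U. (\<lambda>r i. r (z, i)) (restrict (\<lambda>p. U p) ({z} \<times> UNIV))) (UNIV :: int set)"
    by (rule indep_vars_compose2)
       (intro measurable_abs_UNIV measurable_component_singleton, simp)
  then show ?thesis by simp
qed

section \<open>Annealed coins and the Markov property of the generations\<close>

context cookie_law
begin

text \<open>The coins are \<open>coin (\<omega>, U) z i \<longleftrightarrow> U (z, i) < \<omega> z (Suc i)\<close> with independent uniform \<open>U\<close>, so that
  quenched statements follow from annealed ones by Fubini. Coins are counted from 0, cookies from 1.\<close>

definition annealed :: "((int \<Rightarrow> nat \<Rightarrow> real) \<times> (int \<times> nat \<Rightarrow> real)) measure" where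
  "annealed = P \<Otimes>\<^sub>M noise"

definition at_site :: "int \<Rightarrow> (int \<Rightarrow> nat \<Rightarrow> real) \<times> (int \<times> nat \<Rightarrow> real) \<Rightarrow> (nat \<Rightarrow> real) \<times> (nat \<Rightarrow> real)" where
  "at_site z x = (fst x z, \<lambda>i. snd x (z, i))"

lemma sets_annealed [measurable_cong]: "sets annealed = sets (P \<Otimes>\<^sub>M noise)"
  by (simp add: annealed_def)

lemma prob_space_annealed: "prob_space annealed"
proof -
  interpret N: prob_space noise by (rule prob_space_noise)
  interpret pair_prob_space P noise ..
  show ?thesis unfolding annealed_def by (rule prob_space_axioms)
qed

lemma measurable_at_site [measurable]: "at_site z \<in> measurable annealed (cookie_space \<Otimes>\<^sub>M rows)"
  unfolding at_site_def[abs_def] annealed_def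
  by (intro measurable_Pair measurable_compose[OF measurable_fst measurable_site]
      measurable_compose[OF measurable_snd measurable_noise_row])

lemma distr_at_site: "distr annealed (cookie_space \<Otimes>\<^sub>M rows) (at_site z) = site"
proof -
  interpret R: prob_space rows by (rule prob_space_rows)
  have "site = distr P cookie_space (\<lambda>\<omega>. \<omega> z) \<Otimes>\<^sub>M distr noise rows (\<lambda>U i. U (z, i))"
    by (simp add: site_def law_eq distr_noise_row)
  also have "\<dots> = distr (P \<Otimes>\<^sub>M noise) (cookie_space \<Otimes>\<^sub>M rows) (\<lambda>(\<omega>, U). (\<omega> z, \<lambda>i. U (z, i)))"
    by (rule pair_measure_distr) (auto simp: distr_noise_row R.sigma_finite_measure_axioms)
  finally show ?thesis
    by (simp add: annealed_def at_site_def[abs_def] split_beta')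
qed

lemma indep_at_site: "prob_space.indep_vars annealed (\<lambda>z. cookie_space \<Otimes>\<^sub>M rows) at_site UNIV"
  unfolding annealed_def at_site_def[abs_def]
  by (rule indep_vars_pair[OF prob_space_axioms prob_space_noise indep_cookies indep_noise_rows])

definition coin :: "(int \<Rightarrow> nat \<Rightarrow> real) \<times> (int \<times> nat \<Rightarrow> real) \<Rightarrow> int \<Rightarrow> nat \<Rightarrow> bool" where
  "coin x z i \<longleftrightarrow> snd x (z, i) < fst x z (Suc i)"

lemma coins_at_site: "coins s (fst (at_site z x)) (snd (at_site z x)) = (\<lambda>i. coin x z i = s)"
  by (auto simp: coins_def coin_def at_site_def fun_eq_iff)

lemma AE_good_rows: "AE x in annealed. good_rows (coin x)"
proof -
  have "AE x in annealed. reaches m (\<lambda>i. coin x z i = s)" for s z m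
  proof -
    have "AE w in distr annealed (cookie_space \<Otimes>\<^sub>M rows) (at_site z). reaches m (coins s (fst w) (snd w))"
      unfolding distr_at_site by (rule AE_site_reaches)
    then show ?thesis
      by (subst (asm) AE_distr_iff) (auto simp: coins_at_site)
  qed
  then show ?thesis unfolding good_rows_def by (simp add: AE_all_countable)
qed

text \<open>The generations as a function of the site data, so that dependence on finitely many
  sites can be expressed by restricting \<open>y\<close>.\<close>

primrec chain :: "bool \<Rightarrow> nat \<Rightarrow> nat \<Rightarrow> (int \<Rightarrow> (nat \<Rightarrow> real) \<times> (nat \<Rightarrow> real)) \<Rightarrow> nat" where
  "chain s m 0 y = m"
| "chain s m (Suc k) y = offspring s (chain s m k y) (y (side s (int (Suc k))))"

lemma gens_eq_chain: "gens s (coin x) m k = chain s m k (\<lambda>z. at_site z x)"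
proof (induction k)
  case (Suc k)
  have "row s (coin x) (Suc k) = coins s (fst (at_site (side s (int (Suc k))) x)) (snd (at_site (side s (int (Suc k))) x))"
    unfolding coins_at_site row_def ..
  with Suc show ?case by (simp add: offspring_def)
qed simp

lemma chain_restrict:
  "(\<And>j. 1 \<le> j \<Longrightarrow> j \<le> k \<Longrightarrow> side s (int j) \<in> A) \<Longrightarrow> chain s m k (restrict y A) = chain s m k y"
proof (induction k)
  case (Suc k)
  have "side s (int (Suc k)) \<in> A" by (rule Suc.prems) auto
  with Suc show ?case by simp
qed simp

lemma measurable_chain:
  "(\<And>j. 1 \<le> j \<Longrightarrow> j \<le> k \<Longrightarrow> side s (int j) \<in> A) \<Longrightarrow>
    chain s m k \<in> measurable (PiM A (\<lambda>_. cookie_space \<Otimes>\<^sub>M rows)) (count_space UNIV)"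
proof (induction k)
  case 0
  then show ?case by simp
next
  case (Suc k)
  have "side s (int (Suc k)) \<in> A" by (rule Suc.prems) auto
  then have site: "(\<lambda>y. y (side s (int (Suc k)))) \<in>
      measurable (PiM A (\<lambda>_. cookie_space \<Otimes>\<^sub>M rows)) (cookie_space \<Otimes>\<^sub>M rows)"
    by (rule measurable_component_singleton)
  have "chain s m k \<in> measurable (PiM A (\<lambda>_. cookie_space \<Otimes>\<^sub>M rows)) (count_space UNIV)"
    using Suc by auto
  then have "(\<lambda>y. offspring s (chain s m k y) (y (side s (int (Suc k))))) \<in>
      measurable (PiM A (\<lambda>_. cookie_space \<Otimes>\<^sub>M rows)) (count_space UNIV)"
    by (rule measurable_compose_countable[OF measurable_compose[OF site offspring_measurable]])
  moreover have "chain s m (Suc k) = (\<lambda>y. offspring s (chain s m k y) (y (side s (int (Suc k)))))"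
    by (rule ext) simp
  ultimately show ?case by (simp only:)
qed

lemma measurable_gens [measurable]:
  "(\<lambda>x. gens s (coin x) m k) \<in> measurable annealed (count_space UNIV)"
proof -
  have "(\<lambda>x z. at_site z x) \<in> measurable annealed (PiM UNIV (\<lambda>_. cookie_space \<Otimes>\<^sub>M rows))"
    by (intro measurable_abs_UNIV measurable_at_site)
  then show ?thesis
    unfolding gens_eq_chain by (rule measurable_compose) (rule measurable_chain, simp)
qed

text \<open>Markov property: generation \<open>k\<close> depends on the sites in \<open>J\<close>
  only, and the next one adds the fresh site \<open>?z\<close> of law \<open>site\<close>. By
  independence the joint law is a product, and Fubini applies.\<close>

lemma gens_step:
  fixes u :: "nat \<Rightarrow> ennreal"
  shows "(\<integral>\<^sup>+x. u (gens s (coin x) m (Suc k)) \<partial>annealed) =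
    (\<integral>\<^sup>+x. (\<integral>\<^sup>+w. u (offspring s (gens s (coin x) m k) w) \<partial>site) \<partial>annealed)"
proof -
  interpret A: prob_space annealed by (rule prob_space_annealed)
  let ?S = "cookie_space \<Otimes>\<^sub>M rows :: ((nat \<Rightarrow> real) \<times> (nat \<Rightarrow> real)) measure"
  let ?z = "side s (int (Suc k))"
  let ?V = "\<lambda>x. gens s (coin x) m k"
  let ?R = "\<lambda>I x. restrict (\<lambda>z. at_site z x) I"
  define J where "J = (\<lambda>j. side s (int j)) ` {1..k}"
  have J: "?z \<notin> J" "\<And>j. 1 \<le> j \<Longrightarrow> j \<le> k \<Longrightarrow> side s (int j) \<in> J"
    by (auto simp: J_def side_def)
  have "A.indep_var (PiM J (\<lambda>_. ?S)) (\<lambda>x. restrict (\<lambda>z. at_site z x) J)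
      (PiM {?z} (\<lambda>_. ?S)) (\<lambda>x. restrict (\<lambda>z. at_site z x) {?z})"
    using J by (intro A.indep_var_restrict[OF indep_at_site]) auto
  then have D: "distr annealed (PiM J (\<lambda>_. ?S) \<Otimes>\<^sub>M PiM {?z} (\<lambda>_. ?S)) (\<lambda>x. (?R J x, ?R {?z} x)) =
      distr annealed (PiM J (\<lambda>_. ?S)) (?R J) \<Otimes>\<^sub>M distr annealed (PiM {?z} (\<lambda>_. ?S)) (?R {?z})"
    unfolding A.indep_var_distribution_eq by simp
  have R [measurable]: "?R I \<in> measurable annealed (PiM I (\<lambda>_. ?S))" for I
    by (intro measurable_restrict measurable_at_site)
  interpret Z: prob_space "distr annealed (PiM {?z} (\<lambda>_. ?S)) (?R {?z})"
    by (intro A.prob_space_distr R)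
  define g where "g p = u (offspring s (chain s m k (fst p)) (snd p ?z))"
    for p :: "(int \<Rightarrow> (nat \<Rightarrow> real) \<times> (nat \<Rightarrow> real)) \<times> (int \<Rightarrow> (nat \<Rightarrow> real) \<times> (nat \<Rightarrow> real))"
  have chain: "chain s m k \<in> measurable (PiM J (\<lambda>_. ?S)) (count_space UNIV)"
    by (rule measurable_chain) (rule J(2))
  have comp: "(\<lambda>y. y ?z) \<in> measurable (PiM {?z} (\<lambda>_. ?S)) ?S"
    by (rule measurable_component_singleton) simp
  have off: "(\<lambda>y. u (offspring s n (y ?z))) \<in> borel_measurable (PiM {?z} (\<lambda>_. ?S))" for n
    by (rule measurable_compose[OF measurable_compose[OF comp offspring_measurable]]) simp
  have g: "g \<in> borel_measurable (PiM J (\<lambda>_. ?S) \<Otimes>\<^sub>M PiM {?z} (\<lambda>_. ?S))"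
    unfolding g_def[abs_def]
    by (rule measurable_compose_countable[OF measurable_compose[OF measurable_snd off]
          measurable_compose[OF measurable_fst chain]])
  have V: "chain s m k (?R J x) = ?V x" for x
    using J(2) by (simp add: gens_eq_chain chain_restrict)
  have "(\<integral>\<^sup>+x. u (gens s (coin x) m (Suc k)) \<partial>annealed) = (\<integral>\<^sup>+x. g (?R J x, ?R {?z} x) \<partial>annealed)"
    unfolding g_def fst_conv snd_conv V unfolding gens_eq_chain by simp
  also have "\<dots> = (\<integral>\<^sup>+p. g p \<partial>(distr annealed (PiM J (\<lambda>_. ?S)) (?R J) \<Otimes>\<^sub>M
      distr annealed (PiM {?z} (\<lambda>_. ?S)) (?R {?z})))"
    unfolding D[symmetric] by (rule nn_integral_distr_borel[symmetric, OF _ g]) measurable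
  also have "\<dots> = (\<integral>\<^sup>+y. \<integral>\<^sup>+y'. g (y, y') \<partial>distr annealed (PiM {?z} (\<lambda>_. ?S)) (?R {?z})
      \<partial>distr annealed (PiM J (\<lambda>_. ?S)) (?R J))"
  proof (rule Z.nn_integral_fst[symmetric])
    show "g \<in> borel_measurable (distr annealed (PiM J (\<lambda>_. ?S)) (?R J) \<Otimes>\<^sub>M
      distr annealed (PiM {?z} (\<lambda>_. ?S)) (?R {?z}))"
      unfolding D[symmetric] using g by simp
  qed
  also have "\<dots> = (\<integral>\<^sup>+y. (\<integral>\<^sup>+w. u (offspring s (chain s m k y) w) \<partial>site)
      \<partial>distr annealed (PiM J (\<lambda>_. ?S)) (?R J))"
  proof (rule nn_integral_cong)
    fix y
    have "(\<integral>\<^sup>+y'. g (y, y') \<partial>distr annealed (PiM {?z} (\<lambda>_. ?S)) (?R {?z})) =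
        (\<integral>\<^sup>+x. u (offspring s (chain s m k y) (at_site ?z x)) \<partial>annealed)"
      unfolding g_def fst_conv snd_conv by (subst nn_integral_distr_borel[OF R off]) simp
    also have "\<dots> = (\<integral>\<^sup>+w. u (offspring s (chain s m k y) w) \<partial>distr annealed ?S (at_site ?z))"
      by (rule nn_integral_distr_borel[symmetric, OF measurable_at_site
            measurable_compose[OF offspring_measurable]]) simp
    finally show "(\<integral>\<^sup>+y'. g (y, y') \<partial>distr annealed (PiM {?z} (\<lambda>_. ?S)) (?R {?z})) =
        (\<integral>\<^sup>+w. u (offspring s (chain s m k y) w) \<partial>site)"
      unfolding distr_at_site .
  qed
  also have "\<dots> = (\<integral>\<^sup>+x. (\<integral>\<^sup>+w. u (offspring s (chain s m k (?R J x)) w) \<partial>site) \<partial>annealed)"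
    by (rule nn_integral_distr_borel[OF R measurable_compose[OF chain]]) simp
  finally show ?thesis unfolding V .
qed

lemma emeasure_extinct:
  "emeasure annealed {x \<in> space annealed. gens s (coin x) m k = 0} =
    branching.ext site (offspring s) k m"
proof -
  interpret A: prob_space annealed by (rule prob_space_annealed)
  interpret B: branching site "offspring s" M "rho s" "drift s" "4 ^ M" by (rule branching_site)
  have iter: "(\<integral>\<^sup>+x. u (gens s (coin x) m k) \<partial>annealed) = (B.T ^^ k) u m" for u
  proof (induction k arbitrary: u)
    case 0
    show ?case by (simp add: A.emeasure_space_1)
  next
    case (Suc k)
    show ?case
      unfolding gens_step B.T_def[symmetric] Suc.IH funpow_Suc_right by simp
  qed
  have "emeasure annealed {x \<in> space annealed. gens s (coin x) m k = 0} =
      (\<integral>\<^sup>+x. indicator {x \<in> space annealed. gens s (coin x) m k = 0} x \<partial>annealed)"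
    by (intro nn_integral_indicator[symmetric]) measurable
  also have "\<dots> = (\<integral>\<^sup>+x. (\<lambda>v. if v = 0 then 1 else 0) (gens s (coin x) m k) \<partial>annealed)"
    by (intro nn_integral_cong) (auto simp: indicator_def)
  also have "\<dots> = B.ext k m"
    unfolding B.ext_def by (rule iter)
  finally show ?thesis .
qed

lemma AE_extinct:
  assumes "drift s \<le> 1"
  shows "AE x in annealed. \<forall>m. \<exists>K. gens s (coin x) m K = 0"
proof -
  interpret A: prob_space annealed by (rule prob_space_annealed)
  interpret B: branching site "offspring s" M "rho s" "drift s" "4 ^ M" by (rule branching_site)
  have "AE x in annealed. \<exists>K. gens s (coin x) m K = 0" for m
  proof -
    let ?D = "{x \<in> space annealed. \<exists>K. gens s (coin x) m K = 0}"
    have [measurable]: "?D \<in> sets annealed" by measurable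
    have "B.ext k m \<le> emeasure annealed ?D" for k
      unfolding emeasure_extinct[symmetric] by (intro emeasure_mono) auto
    then have "B.h m \<le> emeasure annealed ?D"
      unfolding B.h_def by (rule SUP_least)
    then have "A.prob ?D = 1"
      using B.h_eq_1[OF assms] A.prob_le_1[of ?D] by (simp add: A.emeasure_eq_measure)
    then show ?thesis by (subst (asm) A.prob_Collect_eq_1) auto
  qed
  then show ?thesis by (simp add: AE_all_countable)
qed

text \<open>Extinction for all \<open>m\<close> implies extinction for any single \<open>m\<close>,
  and the latter has arbitrarily small probability by \<open>extinction_small\<close>.\<close>

lemma AE_survive:
  assumes "1 < drift s"
  shows "AE x in annealed. \<exists>m. \<forall>K. gens s (coin x) m K \<noteq> 0"
proof -
  interpret A: prob_space annealed by (rule prob_space_annealed)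
  interpret B: branching site "offspring s" M "rho s" "drift s" "4 ^ M" by (rule branching_site)
  let ?D = "{x \<in> space annealed. \<forall>m. \<exists>K. gens s (coin x) m K = 0}"
  let ?E = "\<lambda>m k. {x \<in> space annealed. gens s (coin x) m k = 0}"
  have [measurable]: "?D \<in> sets annealed" by measurable
  have small: "emeasure annealed ?D \<le> 0 + ennreal e" if "0 < e" for e
  proof -
    obtain m where m: "\<And>k. B.ext k m \<le> ennreal e"
      using B.extinction_small[OF assms \<open>0 < e\<close>] by blast
    have inc: "incseq (?E m)" by (intro incseq_SucI) auto
    have "emeasure annealed ?D \<le> emeasure annealed (\<Union>k. ?E m k)"
      by (intro emeasure_mono) auto
    also have "\<dots> = (SUP k. emeasure annealed (?E m k))"
      using inc by (intro SUP_emeasure_incseq[symmetric]) auto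
    also have "\<dots> \<le> ennreal e"
      unfolding emeasure_extinct by (intro SUP_least m)
    finally show ?thesis by simp
  qed
  have "emeasure annealed ?D \<le> 0"
    by (rule ennreal_le_epsilon) (rule small)
  then have "AE x in annealed. x \<notin> ?D"
    by (intro AE_not_in) (auto simp: null_sets_def)
  with AE_space show ?thesis by eventually_elim auto
qed

end

section \<open>The path law of the walk\<close>

lemma measurable_walk:
  assumes [measurable]: "\<And>z i. Measurable.pred N (\<lambda>U. c U z i)"
  shows "(\<lambda>U. pos (c U) n) \<in> measurable N (count_space UNIV)"
    and "(\<lambda>U. cnt (c U) n z) \<in> measurable N (count_space UNIV)"
proof -
  have "(\<lambda>U. pos (c U) n) \<in> measurable N (count_space UNIV) \<and>
      (\<forall>z. (\<lambda>U. cnt (c U) n z) \<in> measurable N (count_space UNIV))"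
  proof (induction n)
    case (Suc n)
    then have [measurable]: "(\<lambda>U. pos (c U) n) \<in> measurable N (count_space UNIV)"
      "\<And>z. (\<lambda>U. cnt (c U) n z) \<in> measurable N (count_space UNIV)" by auto
    have "(\<lambda>U. c U z (cnt (c U) n z)) \<in> measurable N (count_space UNIV)" for z
      by (rule measurable_compose_countable[where g = "\<lambda>U. cnt (c U) n z"]) measurable
    then have [measurable]: "Measurable.pred N (\<lambda>U. c U (pos (c U) n) (cnt (c U) n (pos (c U) n)))"
      by (rule measurable_compose_countable) measurable
    show ?case unfolding pos_Suc cnt_Suc by measurable
  qed simp
  then show "(\<lambda>U. pos (c U) n) \<in> measurable N (count_space UNIV)"
    "(\<lambda>U. cnt (c U) n z) \<in> measurable N (count_space UNIV)" by auto
qed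

section \<open>Probabilities of finite paths\<close>

definition visits :: "(nat \<Rightarrow> int) \<Rightarrow> nat \<Rightarrow> nat" where
  "visits p i = card {j. j < i \<and> p j = p i}"

text \<open>\<open>visits\<close> counts strictly earlier visits while cookies are numbered from 1,
  hence the \<open>Suc\<close>.\<close>

definition step_prob :: "(int \<Rightarrow> nat \<Rightarrow> real) \<Rightarrow> (nat \<Rightarrow> int) \<Rightarrow> nat \<Rightarrow> real" where
  "step_prob \<omega> p i =
    (if p (Suc i) = p i + 1 then \<omega> (p i) (Suc (visits p i))
     else if p (Suc i) = p i - 1 then 1 - \<omega> (p i) (Suc (visits p i)) else 0)"

definition path_prob :: "(int \<Rightarrow> nat \<Rightarrow> real) \<Rightarrow> (nat \<Rightarrow> int) \<Rightarrow> nat \<Rightarrow> real" where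
  "path_prob \<omega> p n = (if p 0 = 0 then \<Prod>i<n. step_prob \<omega> p i else 0)"

text \<open>Along a prescribed path it is known in advance which coin each step uses, so the path
  event becomes a condition on these coins.\<close>

lemma pos_path_iff:
  "(\<forall>i\<le>n. pos c i = p i) \<longleftrightarrow>
    p 0 = 0 \<and> (\<forall>i<n. p (Suc i) = p i + (if c (p i) (visits p i) then 1 else -1))"
proof (induction n)
  case (Suc n)
  have "(\<forall>i\<le>Suc n. pos c i = p i) \<longleftrightarrow> (\<forall>i\<le>n. pos c i = p i) \<and> pos c (Suc n) = p (Suc n)"
    by (auto simp: le_Suc_eq)
  also have "\<dots> \<longleftrightarrow> (\<forall>i\<le>n. pos c i = p i) \<and> p (Suc n) = p n + (if c (p n) (visits p n) then 1 else -1)"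
  proof (rule conj_cong[OF refl])
    assume eq: "\<forall>i\<le>n. pos c i = p i"
    then have "{i. i < n \<and> pos c i = p n} = {i. i < n \<and> p i = p n}" by auto
    then have "cnt c n (p n) = visits p n"
      by (simp add: cnt_eq_card visits_def)
    then show "pos c (Suc n) = p (Suc n) \<longleftrightarrow> p (Suc n) = p n + (if c (p n) (visits p n) then 1 else -1)"
      using eq by (auto simp: pos_Suc)
  qed
  also have "\<dots> \<longleftrightarrow> p 0 = 0 \<and> (\<forall>i<Suc n. p (Suc i) = p i + (if c (p i) (visits p i) then 1 else -1))"
    unfolding Suc.IH by (auto simp: less_Suc_eq)
  finally show ?case .
qed auto

text \<open>No coin is used twice; this makes the tosses along a path independent.\<close>

lemma inj_visits: "inj_on (\<lambda>i. (p i, visits p i)) {..<n}"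
proof -
  have "visits p i < visits p j" if "i < j" "p i = p j" for i j
    unfolding visits_def using that by (intro psubset_card_mono) auto
  then show ?thesis
    by (intro inj_onI) (metis less_irrefl linorder_neqE_nat prod.inject)
qed

lemma noise_path_prob:
  assumes \<omega>: "\<And>z i. \<omega> z (Suc i) \<in> {0..1}"
  shows "emeasure noise {U \<in> space noise. \<forall>i\<le>n. pos (\<lambda>z i. U (z, i) < \<omega> z (Suc i)) i = p i} =
    ennreal (path_prob \<omega> p n)"
proof (cases "p 0 = 0 \<and> (\<forall>i<n. p (Suc i) = p i + 1 \<or> p (Suc i) = p i - 1)")
  case False
  then have "path_prob \<omega> p n = 0"
    by (auto simp: path_prob_def step_prob_def)
  moreover have "{U \<in> space noise. \<forall>i\<le>n. pos (\<lambda>z i. U (z, i) < \<omega> z (Suc i)) i = p i} = {}"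
    using False unfolding pos_path_iff by (auto split: if_splits)
  ultimately show ?thesis by (simp only: emeasure_empty ennreal_0)
next
  case True
  interpret U: prob_space unif by (rule prob_space_unif)
  interpret product_prob_space "\<lambda>_. unif" "UNIV :: (int \<times> nat) set" ..
  let ?I = "\<lambda>i. (p i, visits p i)"
  let ?up = "\<lambda>i. p (Suc i) = p i + 1"
  \<comment> \<open>The inverse recovers the step that uses coin \<open>q\<close>;
    \<open>A q\<close> collects the uniform values giving the prescribed outcome.\<close>
  define A where "A q = {x. (x < \<omega> (fst q) (Suc (snd q))) = ?up (the_inv_into {..<n} ?I q)}" for q
  have A_I: "A (?I i) = {x. (x < \<omega> (p i) (Suc (visits p i))) = ?up i}" if "i < n" for i
    using the_inv_into_f_f[OF inj_visits, of i n p] that by (simp add: A_def)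
  have "{U \<in> space noise. \<forall>i\<le>n. pos (\<lambda>z i. U (z, i) < \<omega> z (Suc i)) i = p i} =
      {U \<in> space noise. \<forall>q\<in>?I ` {..<n}. U q \<in> A q}"
    using True unfolding pos_path_iff ball_simps
    by (intro Collect_cong conj_cong refl) (auto simp: A_I split: if_splits)
  also have "emeasure noise \<dots> = (\<Prod>q\<in>?I ` {..<n}. emeasure unif (A q))"
    by (rule emeasure_PiM_Collect) (auto simp: A_def)
  also have "\<dots> = (\<Prod>i<n. emeasure unif (A (?I i)))"
    by (rule prod.reindex_cong[OF inj_visits refl refl])
  also have "\<dots> = (\<Prod>i<n. ennreal (step_prob \<omega> p i))"
  proof (intro prod.cong refl)
    fix i assume "i \<in> {..<n}"
    then show "emeasure unif (A (?I i)) = ennreal (step_prob \<omega> p i)"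
      using True \<omega> by (auto simp: A_I emeasure_unif_coin step_prob_def pr_def)
  qed
  also have "\<dots> = ennreal (path_prob \<omega> p n)"
  proof -
    have "0 \<le> step_prob \<omega> p i" for i
      using \<omega>[of "p i" "visits p i"] by (simp add: step_prob_def)
    then show ?thesis using True by (simp add: path_prob_def prod_ennreal)
  qed
  finally show ?thesis .
qed

text \<open>Induction on the length: \<open>?A n\<close> belongs to the history, so the conditional
  expectation may be integrated over it, and on \<open>?A n\<close> its value is constant.\<close>

lemma erw_path_prob:
  assumes erw: "excited_random_walk \<omega> 0 Q X"
  shows "measure Q {\<xi> \<in> space Q. \<forall>i\<le>n. X i \<xi> = p i} = path_prob \<omega> p n"
proof -
  interpret prob_space Q using erw by (simp add: excited_random_walk_def)
  have X [measurable]: "X n \<in> measurable Q (count_space UNIV)" for n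
    using erw by (simp add: excited_random_walk_def)
  let ?A = "\<lambda>n. {\<xi> \<in> space Q. \<forall>i\<le>n. X i \<xi> = p i}"
  show ?thesis
  proof (induction n)
    case 0
    have start: "prob {\<xi> \<in> space Q. X 0 \<xi> = 0} = 1"
      using erw by (simp add: excited_random_walk_def)
    show ?case
    proof (cases "p 0 = 0")
      case True
      with start show ?thesis by (simp add: path_prob_def)
    next
      case False
      have "AE \<xi> in Q. X 0 \<xi> = 0" using start by (subst (asm) prob_Collect_eq_1) auto
      then have "AE \<xi> in Q. X 0 \<xi> \<noteq> p 0" by eventually_elim (use False in simp)
      then have "prob {\<xi> \<in> space Q. X 0 \<xi> = p 0} = 0" by (subst prob_Collect_eq_0) auto
      with False show ?thesis by (simp add: path_prob_def)
    qed
  next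
    case (Suc n)
    let ?F = "history Q X n"
    let ?f = "\<lambda>\<xi>. \<lambda>i\<in>{..n}. X i \<xi>"
    let ?\<theta> = "\<omega> (p n) (Suc (visits p n))"
    have f: "?f \<in> measurable Q (\<Pi>\<^sub>M i\<in>{..n}. count_space UNIV)" by measurable
    have sub: "subalgebra Q ?F"
      unfolding subalgebra_def history_def
      using sets_image_in_sets[OF refl f] by simp
    interpret fin: finite_measure_subalgebra Q ?F by unfold_locales (rule sub)
    have A_F: "?A n \<in> sets ?F"
    proof -
      have "?f -` (\<Pi>\<^sub>E i\<in>{..n}. {p i}) \<inter> space Q \<in> sets ?F"
        unfolding history_def by (intro in_vimage_algebra sets_PiM_I_finite) auto
      also have "?f -` (\<Pi>\<^sub>E i\<in>{..n}. {p i}) \<inter> space Q = ?A n"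
        by (auto simp: PiE_iff)
      finally show ?thesis .
    qed
    have A [measurable]: "?A n \<in> events" by measurable
    have visits: "num_visits X n \<xi> = Suc (visits p n)" if "\<xi> \<in> ?A n" for \<xi>
    proof -
      have "{i. i \<le> n \<and> X i \<xi> = X n \<xi>} = insert n {j. j < n \<and> p j = p n}"
        using that by auto
      then show ?thesis by (simp add: num_visits_def visits_def)
    qed
    have step: "prob (?A n \<inter> {\<xi> \<in> space Q. X (Suc n) \<xi> = X n \<xi> + d}) = g ?\<theta> * prob (?A n)"
      if ce: "AE \<xi> in Q. real_cond_exp Q ?F (indicator {\<xi>\<in>space Q. X (Suc n) \<xi> = X n \<xi> + d}) \<xi>
          = g (\<omega> (X n \<xi>) (num_visits X n \<xi>))" for d g
    proof -
      let ?B = "{\<xi> \<in> space Q. X (Suc n) \<xi> = X n \<xi> + d}"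
      have B [measurable]: "?B \<in> events" by measurable
      have "prob (?A n \<inter> ?B) = (\<integral>\<xi>\<in>?A n. indicator ?B \<xi> \<partial>Q)"
        unfolding set_lebesgue_integral_def by (simp flip: indicator_inter_arith)
      also have "\<dots> = (\<integral>\<xi>\<in>?A n. real_cond_exp Q ?F (indicator ?B) \<xi> \<partial>Q)"
        by (rule fin.real_cond_exp_intA[OF _ A_F])
           (rule integrable_real_indicator[OF B], simp add: emeasure_eq_measure)
      also have "\<dots> = (\<integral>\<xi>. g ?\<theta> * indicator (?A n) \<xi> \<partial>Q)"
        unfolding set_lebesgue_integral_def
      proof (rule integral_cong_AE)
        show "AE \<xi> in Q. indicat_real (?A n) \<xi> *\<^sub>R real_cond_exp Q ?F (indicator ?B) \<xi> = g ?\<theta> * indicator (?A n) \<xi>"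
          using ce
        proof eventually_elim
          case (elim \<xi>)
          show ?case
          proof (cases "\<xi> \<in> ?A n")
            case True
            then have "X n \<xi> = p n" by simp
            with True elim visits[OF True] show ?thesis by simp
          next
            case False
            then have "indicat_real (?A n) \<xi> = 0" by (rule indicator_simps)
            then show ?thesis by (simp only: scaleR_zero_left mult_zero_right)
          qed
        qed
      qed measurable
      also have "\<dots> = g ?\<theta> * prob (?A n)" by simp
      finally show ?thesis .
    qed
    have up: "prob (?A n \<inter> {\<xi> \<in> space Q. X (Suc n) \<xi> = X n \<xi> + 1}) = ?\<theta> * prob (?A n)"
      using erw by (intro step[of 1 "\<lambda>x. x"]) (simp add: excited_random_walk_def)
    have down: "prob (?A n \<inter> {\<xi> \<in> space Q. X (Suc n) \<xi> = X n \<xi> + -1}) = (1 - ?\<theta>) * prob (?A n)"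
      using erw by (intro step[of "-1" "\<lambda>x. 1 - x"]) (simp add: excited_random_walk_def)
    have "prob (?A (Suc n)) = step_prob \<omega> p n * prob (?A n)"
    proof -
      consider "p (Suc n) = p n + 1" | "p (Suc n) = p n - 1"
        | "p (Suc n) \<noteq> p n + 1" "p (Suc n) \<noteq> p n - 1" by blast
      then show ?thesis
      proof cases
        case 1
        then have "?A (Suc n) = ?A n \<inter> {\<xi> \<in> space Q. X (Suc n) \<xi> = X n \<xi> + 1}"
          by (auto simp: le_Suc_eq)
        with up 1 show ?thesis by (simp add: step_prob_def)
      next
        case 2
        then have "?A (Suc n) = ?A n \<inter> {\<xi> \<in> space Q. X (Suc n) \<xi> = X n \<xi> + -1}"
          by (auto simp: le_Suc_eq)
        with down 2 show ?thesis by (simp add: step_prob_def)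
      next
        case 3
        \<comment> \<open>The two admissible steps already exhaust the probability of
          \<open>?A n\<close>, so any other continuation is null.\<close>
        let ?U = "?A n \<inter> {\<xi> \<in> space Q. X (Suc n) \<xi> = X n \<xi> + 1}"
        let ?D = "?A n \<inter> {\<xi> \<in> space Q. X (Suc n) \<xi> = X n \<xi> + -1}"
        have m: "?U \<in> events" "?D \<in> events" "?A (Suc n) \<in> events" by measurable
        have "prob (?A (Suc n)) + (prob ?U + prob ?D) = prob (?A (Suc n) \<union> (?U \<union> ?D))"
        proof -
          have "?U \<inter> ?D = {}" by auto
          moreover have "?A (Suc n) \<inter> (?U \<union> ?D) = {}"
          proof -
            have "X (Suc n) \<xi> = p (Suc n) \<and> X n \<xi> = p n" if "\<xi> \<in> ?A (Suc n)" for \<xi>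
              using that by simp
            then show ?thesis using 3 by fastforce
          qed
          ultimately show ?thesis
            by (simp only: finite_measure_Union[OF m(1,2)]
                finite_measure_Union[OF m(3) sets.Un[OF m(1,2)]])
        qed
        also have "\<dots> \<le> prob (?A n)"
          by (intro finite_measure_mono) auto
        finally have "prob (?A (Suc n)) \<le> 0"
          unfolding up down by (simp add: algebra_simps)
        then have "prob (?A (Suc n)) = 0" using measure_nonneg[of Q "?A (Suc n)"] by linarith
        with 3 show ?thesis by (simp add: step_prob_def)
      qed
    qed
    with Suc show ?case by (simp add: path_prob_def)
  qed
qed

text \<open>Both laws agree on cylinders by the two path formulas, and cylinders determine a
  probability measure on streams.\<close>

lemma erw_distr_eq:
  assumes erw: "excited_random_walk \<omega> 0 Q X" and \<omega>: "\<And>z i. \<omega> z (Suc i) \<in> {0..1}"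
  shows "distr Q (stream_space (count_space UNIV)) (\<lambda>\<xi>. to_stream (\<lambda>n. X n \<xi>)) =
    distr noise (stream_space (count_space UNIV)) (\<lambda>U. to_stream (pos (\<lambda>z i. U (z, i) < \<omega> z (Suc i))))"
    (is "?L = ?R")
    and erw_stream_measurable:
      "(\<lambda>\<xi>. to_stream (\<lambda>n. X n \<xi>)) \<in> measurable Q (stream_space (count_space UNIV))"
    and noise_stream_measurable:
      "(\<lambda>U. to_stream (pos (\<lambda>z i. U (z, i) < \<omega> z (Suc i)))) \<in> measurable noise (stream_space (count_space UNIV))"
proof -
  interpret Q: prob_space Q using erw by (simp add: excited_random_walk_def)
  interpret N: prob_space noise by (rule prob_space_noise)
  have X [measurable]: "X n \<in> measurable Q (count_space UNIV)" for n
    using erw by (simp add: excited_random_walk_def)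
  have Y [measurable]: "(\<lambda>U. pos (\<lambda>z i. U (z, i) < \<omega> z (Suc i)) n) \<in> measurable noise (count_space UNIV)" for n
    by (rule measurable_walk) measurable
  show mX: "(\<lambda>\<xi>. to_stream (\<lambda>n. X n \<xi>)) \<in> measurable Q (stream_space (count_space UNIV))"
    by (rule measurable_compose[OF _ measurable_to_stream]) (intro measurable_abs_UNIV X)
  have "(\<lambda>U n. pos (\<lambda>z i. U (z, i) < \<omega> z (Suc i)) n) \<in> measurable noise (\<Pi>\<^sub>M i\<in>UNIV. count_space UNIV)"
    by (intro measurable_abs_UNIV Y)
  then show mY: "(\<lambda>U. to_stream (pos (\<lambda>z i. U (z, i) < \<omega> z (Suc i)))) \<in> measurable noise (stream_space (count_space UNIV))"
    by (rule measurable_compose[OF _ measurable_to_stream])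
  show "?L = ?R"
  proof (rule stream_space_eq_sstart[where S = UNIV])
    show "prob_space ?L" by (rule Q.prob_space_distr[OF mX])
    show "prob_space ?R" by (rule N.prob_space_distr[OF mY])
    fix xs :: "int list" assume xs: "xs \<noteq> []"
    then have "i < length xs \<longleftrightarrow> i \<le> length xs - 1" for i
      by (cases xs) auto
    then have start: "to_stream f \<in> sstart UNIV xs \<longleftrightarrow> (\<forall>i\<le>length xs - 1. f i = xs ! i)" for f
      by (simp add: sstart_eq to_stream_def)
    have "emeasure ?L (sstart UNIV xs) = emeasure Q {\<xi> \<in> space Q. \<forall>i\<le>length xs - 1. X i \<xi> = xs ! i}"
      using mX by (subst emeasure_distr) (auto simp: start intro!: arg_cong[where f = "emeasure Q"])
    also have "\<dots> = ennreal (path_prob \<omega> (nth xs) (length xs - 1))"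
      unfolding Q.emeasure_eq_measure erw_path_prob[OF erw] ..
    also have "\<dots> = emeasure noise {U \<in> space noise. \<forall>i\<le>length xs - 1. pos (\<lambda>z i. U (z, i) < \<omega> z (Suc i)) i = xs ! i}"
      by (rule noise_path_prob[where \<omega> = \<omega>, OF \<omega>, symmetric])
    also have "\<dots> = emeasure ?R (sstart UNIV xs)"
      using mY by (subst emeasure_distr) (auto simp: start intro!: arg_cong[where f = "emeasure noise"])
    finally show "emeasure ?L (sstart UNIV xs) = emeasure ?R (sstart UNIV xs)" .
  qed simp_all
qed

text \<open>Fubini passes from the annealed measure to almost every \<omega>; there the coin walk
  and the given walk have the same path law.\<close>

lemma (in cookie_law) AE_transfer:
  assumes erw: "\<And>\<omega>. \<omega> \<in> cookie_envs M \<Longrightarrow> excited_random_walk \<omega> 0 (Q \<omega>) X"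
    and \<Phi>: "Measurable.pred (stream_space (count_space UNIV)) (\<lambda>s. \<Phi> (snth s))"
    and AE: "AE x in annealed. \<Phi> (pos (coin x))"
  shows "AE \<omega> in P. AE \<xi> in Q \<omega>. \<Phi> (\<lambda>n. X n \<xi>)"
proof -
  interpret N: prob_space noise by (rule prob_space_noise)
  interpret pair_prob_space P noise ..
  have "AE \<omega> in P. AE U in noise. \<Phi> (pos (coin (\<omega>, U)))"
    using AE unfolding annealed_def by (rule AE_pair)
  with AE_space show ?thesis
  proof eventually_elim
    case (elim \<omega>)
    have \<omega>: "\<omega> z (Suc i) \<in> {0..1}" for z i
      using cookie_bounds(1)[OF elim(1), of "Suc i" z] by simp
    have erw': "excited_random_walk \<omega> 0 (Q \<omega>) X"
      using erw elim(1) by (simp add: space_P)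
    have snth: "snth (to_stream f) = f" for f :: "nat \<Rightarrow> int"
      by (simp add: to_stream_def fun_eq_iff)
    have coin: "coin (\<omega>, U) = (\<lambda>z i. U (z, i) < \<omega> z (Suc i))" for U
      by (simp add: coin_def fun_eq_iff)
    have "AE s in distr noise (stream_space (count_space UNIV)) (\<lambda>U. to_stream (pos (\<lambda>z i. U (z, i) < \<omega> z (Suc i)))). \<Phi> (snth s)"
      using elim(2) \<Phi> by (subst AE_distr_iff[OF noise_stream_measurable[OF erw' \<omega>]])
        (auto simp: snth coin)
    then have "AE s in distr (Q \<omega>) (stream_space (count_space UNIV)) (\<lambda>\<xi>. to_stream (\<lambda>n. X n \<xi>)). \<Phi> (snth s)"
      unfolding erw_distr_eq[OF erw' \<omega>] .
    then show ?case
      using \<Phi> by (subst (asm) AE_distr_iff[OF erw_stream_measurable[OF erw' \<omega>]]) (auto simp: snth)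
  qed
qed

section \<open>Recurrence and transience\<close>

text \<open>\<open>drift True\<close> and \<open>drift False\<close> are \<delta> and its negative.
  If both are at most 1, both sides die out; otherwise exactly one exceeds 1, that side survives and
  the other dies out.\<close>

theorem theorem1:
  fixes M :: nat
    and P :: "(int \<Rightarrow> nat \<Rightarrow> real) measure"
    and Q :: "(int \<Rightarrow> nat \<Rightarrow> real) \<Rightarrow> 'b measure"
    and X :: "nat \<Rightarrow> 'b \<Rightarrow> int"
  assumes "M \<ge> 1"
    and "prob_space P" and "sets P = sets (env_space M)"
    and "iid_env P"
    and "elliptic_env M P"
    and "\<And>\<omega>. \<omega> \<in> cookie_envs M \<Longrightarrow> excited_random_walk \<omega> 0 (Q \<omega>) X"
  shows "(total_drift M P \<in> {-1..1} \<longrightarrow>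
            (AE \<omega> in P. AE \<xi> in Q \<omega>. infinite {n. X n \<xi> = 0})) \<and>
         (total_drift M P > 1 \<longrightarrow>
            (AE \<omega> in P. AE \<xi> in Q \<omega>. filterlim (\<lambda>n. X n \<xi>) at_top sequentially)) \<and>
         (total_drift M P < -1 \<longrightarrow>
            (AE \<omega> in P. AE \<xi> in Q \<omega>. filterlim (\<lambda>n. X n \<xi>) at_bot sequentially))"
proof -
  interpret cookie_law P M
    using assms(2-5) by (simp add: cookie_law_def cookie_law_axioms_def)
  have transient: "AE x in annealed. filterlim (\<lambda>n. side s (pos (coin x) n)) at_top sequentially"
    if "1 < drift s" for s
  proof -
    have "drift (\<not> s) \<le> 1" using that by (cases s) (auto simp: drift_def)
    from AE_good_rows AE_extinct[OF this] AE_survive[OF that] show ?thesis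
    proof eventually_elim
      case (elim x)
      then obtain m where surv: "\<And>K. gens s (coin x) m K \<noteq> 0" by blast
      show ?case
        by (rule transient_of_survival[OF elim(1) _ surv]) (use elim(2) in blast)
    qed
  qed
  show ?thesis
  proof (intro conjI impI)
    assume "total_drift M P \<in> {-1..1}"
    then have "drift s \<le> 1" for s by (auto simp: drift_def)
    note AE_extinct[OF this, of True] AE_extinct[OF this, of False]
    with AE_good_rows have "AE x in annealed. infinite {n. pos (coin x) n = 0}"
    proof eventually_elim
      case (elim x)
      have "\<exists>K. gens s (coin x) m K = 0" for s m
        using elim(2,3) by (cases s) auto
      with elim(1) show ?case by (rule recurrent_of_extinct)
    qed
    then show "AE \<omega> in P. AE \<xi> in Q \<omega>. infinite {n. X n \<xi> = 0}"
      by (intro AE_transfer[OF assms(6), where \<Phi> = "\<lambda>f. infinite {n. f n = 0}"])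
         (auto simp: infinite_nat_iff_unbounded_le)
  next
    assume "1 < total_drift M P"
    then have "AE x in annealed. filterlim (pos (coin x)) at_top sequentially"
      using transient[of True] by (simp add: drift_def side_def)
    then show "AE \<omega> in P. AE \<xi> in Q \<omega>. filterlim (\<lambda>n. X n \<xi>) at_top sequentially"
      by (intro AE_transfer[OF assms(6), where \<Phi> = "\<lambda>f. filterlim f at_top sequentially"])
         (auto simp: filterlim_at_top eventually_sequentially)
  next
    assume "total_drift M P < - 1"
    then have "AE x in annealed. filterlim (\<lambda>n. - pos (coin x) n) at_top sequentially"
      using transient[of False] by (simp add: drift_def side_def)
    then have "AE x in annealed. filterlim (pos (coin x)) at_bot sequentially"
    proof eventually_elim
      case (elim x)
      show ?case
        unfolding filterlim_at_bot
      proof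
        fix B :: int
        have "\<forall>\<^sub>F n in sequentially. - B \<le> - pos (coin x) n"
          using elim unfolding filterlim_at_top by blast
        then show "\<forall>\<^sub>F n in sequentially. pos (coin x) n \<le> B" by simp
      qed
    qed
    then show "AE \<omega> in P. AE \<xi> in Q \<omega>. filterlim (\<lambda>n. X n \<xi>) at_bot sequentially"
      by (intro AE_transfer[OF assms(6), where \<Phi> = "\<lambda>f. filterlim f at_bot sequentially"])
         (auto simp: filterlim_at_bot eventually_sequentially)
  qed
qed

end
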